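(* Let $\alpha\in PM_n$ be a pseudo braid with $d(\alpha)=d$ pseudo generators, given by a word in the generators $\sigma_i^{\pm1},p_i$. Then $$\mathcal P(\widehat\alpha)=C^d\sum_s\left(XB^{-1}\right)^{r_+(s)}\left(YB\right)^{r_-(s)}\mathcal H(\widehat{\alpha_s}),$$ where the sum runs over all states $s$ of $\alpha$.
   Context: Coefficients. $R$ is a commutative ring containing elements $q,z,X,Y$ with $q$ invertible, $z_-:=q^{-1}z+q^{-1}-1$, and $z$, $z_-$, $Xz+Yz_-$ are invertible in $R$; $B\in R$ satisfies $B^2=z_-/z$, and $A=\frac1{Bz}$, $C=\frac{1}{A(Xz+Yz_-)}$. Pseudo braids. The pseudo braid monoid $PM_n$ is generated by $\sigma_1^{\pm1},\dots,\sigma_{n-1}^{\pm1}$ and the pseudo generators $p_1,\dots,p_{n-1}$, subject to the relations of the braid group $B_n$ among the $\sigma_i^{\pm1}$ and: $p_ip_j=p_jp_i$ and $p_i\sigma_j^{\pm1}=\sigma_j^{\pm1}p_i$ for $|i-j|\ge2$; $p_i\sigma_i^{\pm1}=\sigma_i^{\pm1}p_i$; $\sigma_i\sigma_{i+1}p_i=p_{i+1}\sigma_i\sigma_{i+1}$; $\sigma_{i+1}\sigma_ip_{i+1}=p_i\sigma_{i+1}\sigma_i$. Here $p_i$ represents a pre-crossing (double point without over/under information) between strands $i,i+1$, and $\widehat\alpha$ denotes the closure of $\alpha$, obtained by joining corresponding top and bottom endpoints. $e(\alpha)$ is the exponent sum of the $\sigma_i$ and $d(\alpha)$ the number of letters $p_i$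 in any word representing $\alpha$. The invariant $\mathcal P$. $PH_n(q)=R[PM_n]/\langle\sigma_i^2-(q-1)\sigma_i-q\rangle$ and $H_n(q)=R[B_n]/\langle\sigma_i^2-(q-1)\sigma_i-q\rangle$, with $g_i$ the image of $\sigma_i$; $\pi:B_n\to H_n(q)$ is the canonical projection. $\rho_{X,Y}:PH_n(q)\to H_n(q)$ is the $R$-algebra homomorphism with $g_i\mapsto g_i$, $p_i\mapsto Xg_i+Yg_i^{-1}$. $\operatorname{tr}_n:H_n(q)\to R$ is the Ocneanu trace: the unique family of $R$-linear maps with $\operatorname{tr}_1(1)=1$, $\operatorname{tr}_n(ab)=\operatorname{tr}_n(ba)$, $\operatorname{tr}_{n+1}(a)=\operatorname{tr}_n(a)$, $\operatorname{tr}_{n+1}(ag_n)=z\operatorname{tr}_n(a)$ for $a,b\in H_n(q)$. With $T_n=\operatorname{tr}_n\circ\rho_{X,Y}$, one sets $\mathcal P(\widehat\alpha)=A^{n-1}B^{e(\alpha)}C^{d(\alpha)}T_n(\alpha)$ for $\alpha\in PM_n$, and for a classical braid $\beta\in B_n$ the normalized classical HOMFLYPT-type invariant is $\mathcal H(\widehat\beta)=A^{n-1}B^{e(\beta)}\operatorname{tr}_n(\pi(\beta))$. States. A state $s$ of $\alpha$ is a choice, for each occurrence of a pseudo generator $p_i$ in the given word for $\alpha$, of either the positive generator $\sigma_i$ or the negative generator $\sigma_i^{-1}$ (images $g_i$, $g_i^{-1}$ in $H_n(q)$). $\alpha_s\in B_n$ is the classical braid obtained by replacing each occurrence of $p_i$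 according to this choice; $r_+(s)$ and $r_-(s)$ are the numbers of occurrences replaced by the positive, respectively negative, generator, so $r_+(s)+r_-(s)=d$. *)

theory Defs
  imports "HOL-Algebra.QuotRing" "HOL-Algebra.Module"
begin

text \<open>The least congruence on the words over \<open>S\<close> that contains \<open>Rel\<close>.\<close>

inductive pres_eq :: "'g set \<Rightarrow> ('g list \<times> 'g list) set \<Rightarrow> 'g list \<Rightarrow> 'g list \<Rightarrow> bool"
  for S Rel where
  rel: "(u, v) \<in> Rel \<Longrightarrow> u \<in> lists S \<Longrightarrow> v \<in> lists S \<Longrightarrow> pres_eq S Rel u v"
| refl: "w \<in> lists S \<Longrightarrow> pres_eq S Rel w w"
| sym: "pres_eq S Rel u v \<Longrightarrow> pres_eq S Rel v u"
| trans: "pres_eq S Rel u v \<Longrightarrow> pres_eq S Rel v w \<Longrightarrow> pres_eq S Rel u w"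
| cong: "pres_eq S Rel u u' \<Longrightarrow> pres_eq S Rel v v' \<Longrightarrow> pres_eq S Rel (u @ v) (u' @ v')"

definition word_class :: "'g set \<Rightarrow> ('g list \<times> 'g list) set \<Rightarrow> 'g list \<Rightarrow> 'g list set" where
  "word_class S Rel w = {v. pres_eq S Rel w v}"

definition presented_monoid :: "'g set \<Rightarrow> ('g list \<times> 'g list) set \<Rightarrow> 'g list set monoid" where
  "presented_monoid S Rel =
     \<lparr>carrier = word_class S Rel ` lists S,
      mult = (\<lambda>U V. \<Union>u\<in>U. \<Union>v\<in>V. word_class S Rel (u @ v)),
      one = word_class S Rel []\<rparr>"

text \<open>\<open>Sig i\<close>, \<open>SigInv i\<close> and \<open>Pre i\<close> stand for the generators \<open>\<sigma>\<^sub>i\<close>, its inverse, and \<open>p\<^sub>i\<close>.\<close>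

datatype letter = Sig nat | SigInv nat | Pre nat

definition braid_letters :: "nat \<Rightarrow> letter set" where
  "braid_letters n = (\<Union>i\<in>{1..<n}. {Sig i, SigInv i})"

definition pseudo_letters :: "nat \<Rightarrow> letter set" where
  "pseudo_letters n = (\<Union>i\<in>{1..<n}. {Sig i, SigInv i, Pre i})"

text \<open>The Artin group presentation, written as a monoid presentation with inverse letters.\<close>

definition braid_rels :: "nat \<Rightarrow> (letter list \<times> letter list) set" where
  "braid_rels n =
     {([Sig i, SigInv i], []) | i. i \<in> {1..<n}} \<union>
     {([SigInv i, Sig i], []) | i. i \<in> {1..<n}} \<union>
     {([Sig i, Sig j], [Sig j, Sig i]) | i j.
        i \<in> {1..<n} \<and> j \<in> {1..<n} \<and> 2 \<le> \<bar>int i - int j\<bar>} \<union>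
     {([Sig i, Sig (i+1), Sig i], [Sig (i+1), Sig i, Sig (i+1)]) | i.
        i \<in> {1..<n} \<and> i + 1 \<in> {1..<n}}"

definition pseudo_rels :: "nat \<Rightarrow> (letter list \<times> letter list) set" where
  "pseudo_rels n =
     {([Pre i, Pre j], [Pre j, Pre i]) | i j.
        i \<in> {1..<n} \<and> j \<in> {1..<n} \<and> 2 \<le> \<bar>int i - int j\<bar>} \<union>
     {([Pre i, Sig j], [Sig j, Pre i]) | i j.
        i \<in> {1..<n} \<and> j \<in> {1..<n} \<and> 2 \<le> \<bar>int i - int j\<bar>} \<union>
     {([Pre i, SigInv j], [SigInv j, Pre i]) | i j.
        i \<in> {1..<n} \<and> j \<in> {1..<n} \<and> 2 \<le> \<bar>int i - int j\<bar>} \<union>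
     {([Pre i, Sig i], [Sig i, Pre i]) | i. i \<in> {1..<n}} \<union>
     {([Pre i, SigInv i], [SigInv i, Pre i]) | i. i \<in> {1..<n}} \<union>
     {([Sig i, Sig (i+1), Pre i], [Pre (i+1), Sig i, Sig (i+1)]) | i.
        i \<in> {1..<n} \<and> i + 1 \<in> {1..<n}} \<union>
     {([Sig (i+1), Sig i, Pre (i+1)], [Pre i, Sig (i+1), Sig i]) | i.
        i \<in> {1..<n} \<and> i + 1 \<in> {1..<n}}"

definition braid_group :: "nat \<Rightarrow> letter list set monoid" where
  "braid_group n = presented_monoid (braid_letters n) (braid_rels n)"

definition braid_class :: "nat \<Rightarrow> letter list \<Rightarrow> letter list set" where
  "braid_class n = word_class (braid_letters n) (braid_rels n)"

definition pseudo_braid_monoid :: "nat \<Rightarrow> letter list set monoid" where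
  "pseudo_braid_monoid n =
     presented_monoid (pseudo_letters n) (braid_rels n \<union> pseudo_rels n)"

definition pseudo_class :: "nat \<Rightarrow> letter list \<Rightarrow> letter list set" where
  "pseudo_class n = word_class (pseudo_letters n) (braid_rels n \<union> pseudo_rels n)"

fun letter_exp :: "letter \<Rightarrow> int" where
  "letter_exp (Sig i) = 1"
| "letter_exp (SigInv i) = -1"
| "letter_exp (Pre i) = 0"

fun is_pre :: "letter \<Rightarrow> bool" where
  "is_pre (Pre i) = True"
| "is_pre (Sig i) = False"
| "is_pre (SigInv i) = False"

definition word_exp :: "letter list \<Rightarrow> int" where
  "word_exp w = sum_list (map letter_exp w)"

definition word_pre :: "letter list \<Rightarrow> nat" where
  "word_pre w = length (filter is_pre w)"

text \<open>
  All relations preserve \<open>word_exp\<close> and \<open>word_pre\<close>, so the values below do not depend on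
  the word chosen to represent the (pseudo) braid.
\<close>

lemma rels_invariant:
  assumes "(u, v) \<in> braid_rels n \<union> pseudo_rels n"
  shows "word_exp u = word_exp v" "word_pre u = word_pre v"
  using assms by (auto simp: braid_rels_def pseudo_rels_def word_exp_def word_pre_def)

lemma pres_eq_invariant:
  assumes "pres_eq S Rel u v" and "Rel \<subseteq> braid_rels n \<union> pseudo_rels n"
  shows "word_exp u = word_exp v \<and> word_pre u = word_pre v"
  using assms(1)
proof induction
  case (rel u v)
  then show ?case using rels_invariant[of u v n] assms(2) by blast
qed (auto simp: word_exp_def word_pre_def)

definition exp_sum :: "letter list set \<Rightarrow> int" where
  "exp_sum \<alpha> = (THE k. \<exists>w\<in>\<alpha>. word_exp w = k)"

definition pre_count :: "letter list set \<Rightarrow> nat" where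
  "pre_count \<alpha> = (THE k. \<exists>w\<in>\<alpha>. word_pre w = k)"

lemma exp_sum_pseudo_class:
  assumes "w \<in> lists (pseudo_letters n)"
  shows "exp_sum (pseudo_class n w) = word_exp w"
    and "pre_count (pseudo_class n w) = word_pre w"
proof -
  have mem: "w \<in> pseudo_class n w"
    using assms by (simp add: pseudo_class_def word_class_def pres_eq.refl)
  have inv: "word_exp v = word_exp w \<and> word_pre v = word_pre w" if "v \<in> pseudo_class n w" for v
  proof -
    have "pres_eq (pseudo_letters n) (braid_rels n \<union> pseudo_rels n) w v"
      using that by (simp add: pseudo_class_def word_class_def)
    from pres_eq_invariant[OF this, of n] show ?thesis
      by simp
  qed
  show "exp_sum (pseudo_class n w) = word_exp w"
    unfolding exp_sum_def by (rule the_equality) (use mem inv in metis)+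
  show "pre_count (pseudo_class n w) = word_pre w"
    unfolding pre_count_def by (rule the_equality) (use mem inv in metis)+
qed

lemma exp_sum_braid_class:
  assumes "w \<in> lists (braid_letters n)"
  shows "exp_sum (braid_class n w) = word_exp w"
proof -
  have mem: "w \<in> braid_class n w"
    using assms by (simp add: braid_class_def word_class_def pres_eq.refl)
  have inv: "word_exp v = word_exp w" if "v \<in> braid_class n w" for v
  proof -
    have "pres_eq (braid_letters n) (braid_rels n) w v"
      using that by (simp add: braid_class_def word_class_def)
    from pres_eq_invariant[OF this, of n] show ?thesis
      by simp
  qed
  show ?thesis
    unfolding exp_sum_def by (rule the_equality) (use mem inv in metis)+
qed

text \<open>
  Occurrences of pseudo generators are recorded by their positions in the word; a state
  assigns \<open>True\<close> (positive generator) or \<open>False\<close> (negative generator) to each of them.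
\<close>

definition pre_positions :: "letter list \<Rightarrow> nat set" where
  "pre_positions w = {k. k < length w \<and> is_pre (w ! k)}"

definition states :: "letter list \<Rightarrow> (nat \<Rightarrow> bool) set" where
  "states w = pre_positions w \<rightarrow>\<^sub>E (UNIV :: bool set)"

definition resolve :: "letter list \<Rightarrow> (nat \<Rightarrow> bool) \<Rightarrow> letter list" where
  "resolve w s =
     map (\<lambda>k. case w ! k of Pre i \<Rightarrow> (if s k then Sig i else SigInv i) | l \<Rightarrow> l) [0..<length w]"

definition r_plus :: "letter list \<Rightarrow> (nat \<Rightarrow> bool) \<Rightarrow> nat" where
  "r_plus w s = card {k \<in> pre_positions w. s k}"

definition r_minus :: "letter list \<Rightarrow> (nat \<Rightarrow> bool) \<Rightarrow> nat" where
  "r_minus w s = card {k \<in> pre_positions w. \<not> s k}"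

definition monoid_algebra ::
    "('r, 'x) ring_scheme \<Rightarrow> ('m, 'y) monoid_scheme \<Rightarrow> ('r, 'm \<Rightarrow> 'r) module" where
  "monoid_algebra R M =
     \<lparr>carrier = {a. (\<forall>m\<in>carrier M. a m \<in> carrier R) \<and> (\<forall>m. m \<notin> carrier M \<longrightarrow> a m = \<zero>\<^bsub>R\<^esub>) \<and>
                    finite {m \<in> carrier M. a m \<noteq> \<zero>\<^bsub>R\<^esub>}},
      mult = (\<lambda>a b m. \<Oplus>\<^bsub>R\<^esub>p\<in>{(u, v). u \<in> carrier M \<and> v \<in> carrier M \<and> a u \<noteq> \<zero>\<^bsub>R\<^esub> \<and>
                                b v \<noteq> \<zero>\<^bsub>R\<^esub> \<and> u \<otimes>\<^bsub>M\<^esub> v = m}. a (fst p) \<otimes>\<^bsub>R\<^esub> b (snd p)),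
      one = (\<lambda>m. if m = \<one>\<^bsub>M\<^esub> then \<one>\<^bsub>R\<^esub> else \<zero>\<^bsub>R\<^esub>),
      zero = (\<lambda>m. \<zero>\<^bsub>R\<^esub>),
      add = (\<lambda>a b m. a m \<oplus>\<^bsub>R\<^esub> b m),
      smult = (\<lambda>c a m. c \<otimes>\<^bsub>R\<^esub> a m)\<rparr>"

definition basis_elem :: "('r, 'x) ring_scheme \<Rightarrow> 'm \<Rightarrow> 'm \<Rightarrow> 'r" where
  "basis_elem R m = (\<lambda>x. if x = m then \<one>\<^bsub>R\<^esub> else \<zero>\<^bsub>R\<^esub>)"

text \<open>\<^const>\<open>FactRing\<close> forgets the scalar multiplication; it is restored here.\<close>

definition quotient_algebra :: "('r, 'a) module \<Rightarrow> 'a set \<Rightarrow> ('r, 'a set) module" where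
  "quotient_algebra A I =
     ring.extend (A Quot I) (module.fields (\<lambda>c U. \<Union>a\<in>U. I +>\<^bsub>A\<^esub> (c \<odot>\<^bsub>A\<^esub> a)))"

definition alg_hom ::
    "('r, 'x) ring_scheme \<Rightarrow> ('r, 'a) module \<Rightarrow> ('r, 'b) module \<Rightarrow> ('a \<Rightarrow> 'b) set" where
  "alg_hom R A B =
     {f \<in> ring_hom A B. \<forall>c\<in>carrier R. \<forall>a\<in>carrier A. f (c \<odot>\<^bsub>A\<^esub> a) = c \<odot>\<^bsub>B\<^esub> f a}"

definition linear_form :: "('r, 'x) ring_scheme \<Rightarrow> ('r, 'a) module \<Rightarrow> ('a \<Rightarrow> 'r) \<Rightarrow> bool" where
  "linear_form R A f \<longleftrightarrow>
     (\<forall>a\<in>carrier A. f a \<in> carrier R) \<and>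
     (\<forall>a\<in>carrier A. \<forall>b\<in>carrier A. f (a \<oplus>\<^bsub>A\<^esub> b) = f a \<oplus>\<^bsub>R\<^esub> f b) \<and>
     (\<forall>c\<in>carrier R. \<forall>a\<in>carrier A. f (c \<odot>\<^bsub>A\<^esub> a) = c \<otimes>\<^bsub>R\<^esub> f a)"

text \<open>The elements \<open>\<sigma>\<^sub>i\<^sup>2 - (q - 1) \<sigma>\<^sub>i - q\<close> of an algebra in which \<open>\<sigma> i\<close> is the element \<open>\<sigma>\<^sub>i\<close>.\<close>

definition hecke_relators ::
    "('r, 'x) ring_scheme \<Rightarrow> 'r \<Rightarrow> nat \<Rightarrow> ('r, 'a) module \<Rightarrow> (nat \<Rightarrow> 'a) \<Rightarrow> 'a set" where
  "hecke_relators R q n A \<sigma> =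
     {\<sigma> i \<otimes>\<^bsub>A\<^esub> \<sigma> i \<ominus>\<^bsub>A\<^esub> (q \<ominus>\<^bsub>R\<^esub> \<one>\<^bsub>R\<^esub>) \<odot>\<^bsub>A\<^esub> \<sigma> i \<ominus>\<^bsub>A\<^esub> q \<odot>\<^bsub>A\<^esub> \<one>\<^bsub>A\<^esub> | i. i \<in> {1..<n}}"

definition braid_algebra ::
    "('r, 'x) ring_scheme \<Rightarrow> nat \<Rightarrow> ('r, letter list set \<Rightarrow> 'r) module" where
  "braid_algebra R n = monoid_algebra R (braid_group n)"

definition hecke_ideal ::
    "('r, 'x) ring_scheme \<Rightarrow> 'r \<Rightarrow> nat \<Rightarrow> (letter list set \<Rightarrow> 'r) set" where
  "hecke_ideal R q n =
     Idl\<^bsub>braid_algebra R n\<^esub>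
       (hecke_relators R q n (braid_algebra R n) (\<lambda>i. basis_elem R (braid_class n [Sig i])))"

definition hecke ::
    "('r, 'x) ring_scheme \<Rightarrow> 'r \<Rightarrow> nat \<Rightarrow> ('r, (letter list set \<Rightarrow> 'r) set) module" where
  "hecke R q n = quotient_algebra (braid_algebra R n) (hecke_ideal R q n)"

text \<open>The canonical projection \<open>\<pi>\<close> from the braid group.\<close>

definition hecke_proj ::
    "('r, 'x) ring_scheme \<Rightarrow> 'r \<Rightarrow> nat \<Rightarrow> letter list set \<Rightarrow> (letter list set \<Rightarrow> 'r) set" where
  "hecke_proj R q n \<beta> = hecke_ideal R q n +>\<^bsub>braid_algebra R n\<^esub> basis_elem R \<beta>"

definition hecke_gen ::
    "('r, 'x) ring_scheme \<Rightarrow> 'r \<Rightarrow> nat \<Rightarrow> nat \<Rightarrow> (letter list set \<Rightarrow> 'r) set" where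
  "hecke_gen R q n i = hecke_proj R q n (braid_class n [Sig i])"

definition pseudo_algebra ::
    "('r, 'x) ring_scheme \<Rightarrow> nat \<Rightarrow> ('r, letter list set \<Rightarrow> 'r) module" where
  "pseudo_algebra R n = monoid_algebra R (pseudo_braid_monoid n)"

definition pseudo_hecke_ideal ::
    "('r, 'x) ring_scheme \<Rightarrow> 'r \<Rightarrow> nat \<Rightarrow> (letter list set \<Rightarrow> 'r) set" where
  "pseudo_hecke_ideal R q n =
     Idl\<^bsub>pseudo_algebra R n\<^esub>
       (hecke_relators R q n (pseudo_algebra R n) (\<lambda>i. basis_elem R (pseudo_class n [Sig i])))"

definition pseudo_hecke ::
    "('r, 'x) ring_scheme \<Rightarrow> 'r \<Rightarrow> nat \<Rightarrow> ('r, (letter list set \<Rightarrow> 'r) set) module" where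
  "pseudo_hecke R q n = quotient_algebra (pseudo_algebra R n) (pseudo_hecke_ideal R q n)"

definition pseudo_hecke_proj ::
    "('r, 'x) ring_scheme \<Rightarrow> 'r \<Rightarrow> nat \<Rightarrow> letter list set \<Rightarrow> (letter list set \<Rightarrow> 'r) set" where
  "pseudo_hecke_proj R q n \<alpha> = pseudo_hecke_ideal R q n +>\<^bsub>pseudo_algebra R n\<^esub> basis_elem R \<alpha>"

text \<open>
  The algebra homomorphism \<open>\<rho>\<close> with \<open>g\<^sub>i \<mapsto> g\<^sub>i\<close> and \<open>p\<^sub>i \<mapsto> X g\<^sub>i + Y g\<^sub>i\<^sup>-\<^sup>1\<close>. Restricting to
  extensional functions makes it unique as a function on the whole type.
\<close>

definition rho ::
    "('r, 'x) ring_scheme \<Rightarrow> 'r \<Rightarrow> 'r \<Rightarrow> 'r \<Rightarrow> nat \<Rightarrow>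
     (letter list set \<Rightarrow> 'r) set \<Rightarrow> (letter list set \<Rightarrow> 'r) set" where
  "rho R q X Y n =
     (THE f. f \<in> alg_hom R (pseudo_hecke R q n) (hecke R q n) \<and>
        f \<in> extensional (carrier (pseudo_hecke R q n)) \<and>
        (\<forall>i\<in>{1..<n}.
           f (pseudo_hecke_proj R q n (pseudo_class n [Sig i])) = hecke_gen R q n i \<and>
           f (pseudo_hecke_proj R q n (pseudo_class n [Pre i])) =
             X \<odot>\<^bsub>hecke R q n\<^esub> hecke_gen R q n i \<oplus>\<^bsub>hecke R q n\<^esub>
             Y \<odot>\<^bsub>hecke R q n\<^esub> inv\<^bsub>hecke R q n\<^esub> (hecke_gen R q n i)))"

text \<open>The canonical algebra homomorphism from the \<open>n\<close>-th to the \<open>n + 1\<close>-st Hecke algebra.\<close>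

definition hecke_incl ::
    "('r, 'x) ring_scheme \<Rightarrow> 'r \<Rightarrow> nat \<Rightarrow>
     (letter list set \<Rightarrow> 'r) set \<Rightarrow> (letter list set \<Rightarrow> 'r) set" where
  "hecke_incl R q n =
     (THE f. f \<in> alg_hom R (hecke R q n) (hecke R q (n+1)) \<and>
        f \<in> extensional (carrier (hecke R q n)) \<and>
        (\<forall>i\<in>{1..<n}. f (hecke_gen R q n i) = hecke_gen R q (n+1) i))"

text \<open>
  The axioms that characterise the Ocneanu trace \<open>(tr\<^sub>n)\<close>, \<open>n \<ge> 1\<close>. The value \<open>tr 0\<close> is
  irrelevant.
\<close>

definition ocneanu_trace ::
    "('r, 'x) ring_scheme \<Rightarrow> 'r \<Rightarrow> 'r \<Rightarrow> (nat \<Rightarrow> (letter list set \<Rightarrow> 'r) set \<Rightarrow> 'r) \<Rightarrow> bool" where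
  "ocneanu_trace R q z tr \<longleftrightarrow>
     (\<forall>n\<ge>1. linear_form R (hecke R q n) (tr n)) \<and>
     tr 1 \<one>\<^bsub>hecke R q 1\<^esub> = \<one>\<^bsub>R\<^esub> \<and>
     (\<forall>n\<ge>1. \<forall>a\<in>carrier (hecke R q n). \<forall>b\<in>carrier (hecke R q n).
        tr n (a \<otimes>\<^bsub>hecke R q n\<^esub> b) = tr n (b \<otimes>\<^bsub>hecke R q n\<^esub> a)) \<and>
     (\<forall>n\<ge>1. \<forall>a\<in>carrier (hecke R q n). tr (n+1) (hecke_incl R q n a) = tr n a) \<and>
     (\<forall>n\<ge>1. \<forall>a\<in>carrier (hecke R q n).
        tr (n+1) (hecke_incl R q n a \<otimes>\<^bsub>hecke R q (n+1)\<^esub> hecke_gen R q (n+1) n) = z \<otimes>\<^bsub>R\<^esub> tr n a)"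

definition T_pseudo ::
    "('r, 'x) ring_scheme \<Rightarrow> 'r \<Rightarrow> 'r \<Rightarrow> 'r \<Rightarrow> (nat \<Rightarrow> (letter list set \<Rightarrow> 'r) set \<Rightarrow> 'r) \<Rightarrow>
     nat \<Rightarrow> letter list set \<Rightarrow> 'r" where
  "T_pseudo R q X Y tr n \<alpha> = tr n (rho R q X Y n (pseudo_hecke_proj R q n \<alpha>))"

text \<open>
  Both invariants of the closure of a (pseudo) braid on \<open>n \<ge> 1\<close> strands are defined through
  the number of strands and the (pseudo) braid itself. The exponent of \<open>B\<close> is an integer.
\<close>

definition pseudo_P ::
    "('r, 'x) ring_scheme \<Rightarrow> 'r \<Rightarrow> 'r \<Rightarrow> 'r \<Rightarrow> 'r \<Rightarrow> 'r \<Rightarrow> 'r \<Rightarrow>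
     (nat \<Rightarrow> (letter list set \<Rightarrow> 'r) set \<Rightarrow> 'r) \<Rightarrow> nat \<Rightarrow> letter list set \<Rightarrow> 'r" where
  "pseudo_P R q X Y A B C tr n \<alpha> =
     A [^]\<^bsub>R\<^esub> (n - 1) \<otimes>\<^bsub>R\<^esub> B [^]\<^bsub>R\<^esub> exp_sum \<alpha> \<otimes>\<^bsub>R\<^esub> C [^]\<^bsub>R\<^esub> pre_count \<alpha> \<otimes>\<^bsub>R\<^esub>
     T_pseudo R q X Y tr n \<alpha>"

definition classical_H ::
    "('r, 'x) ring_scheme \<Rightarrow> 'r \<Rightarrow> 'r \<Rightarrow> 'r \<Rightarrow>
     (nat \<Rightarrow> (letter list set \<Rightarrow> 'r) set \<Rightarrow> 'r) \<Rightarrow> nat \<Rightarrow> letter list set \<Rightarrow> 'r" where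
  "classical_H R q A B tr n \<beta> =
     A [^]\<^bsub>R\<^esub> (n - 1) \<otimes>\<^bsub>R\<^esub> B [^]\<^bsub>R\<^esub> exp_sum \<beta> \<otimes>\<^bsub>R\<^esub> tr n (hecke_proj R q n \<beta>)"

end

theory Submission
  imports Defs
begin

text \<open>
  A state sum is the expansion of a product of binomials: \<open>\<rho>\<close> sends the class of a pseudo braid word to
  the product of the images of its letters, and multiplying out the factors \<open>X g\<^sub>i + Y g\<^sub>i\<^sup>-\<^sup>1\<close> gives one
  term \<open>X\<^bsup>r\<^sub>+\<^esup> Y\<^bsup>r\<^sub>-\<^esup> \<pi>(\<alpha>\<^sub>s)\<close> for every state \<open>s\<close>. The powers
  of \<open>B\<close> match because \<open>e(\<alpha>\<^sub>s) = e(\<alpha>) + r\<^sub>+(s) - r\<^sub>-(s)\<close>.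

  What needs work is that \<open>\<rho>\<close>, given by a definite description, exists and is unique. Existence follows
  from the universal properties of presented monoids, monoid algebras and quotients; the mixed
  relations hold because \<open>z x = y z\<close> implies \<open>z x\<^sup>-\<^sup>1 = y\<^sup>-\<^sup>1 z\<close>, hence
  \<open>z (X x + Y x\<^sup>-\<^sup>1) = (X y + Y y\<^sup>-\<^sup>1) z\<close>. The ring laws of the monoid algebra are checked
  by pairing its elements with arbitrary functions on the monoid.
\<close>

subsection \<open>Presented monoids\<close>

text \<open>The product of a monoid algebra is a convolution: each coefficient is a sum over the
  pairs with a prescribed product, so its index set changes with the coefficient, and associativity
  would mean regrouping sums over triples. Pairing with a function \<open>\<phi>\<close> removes the
  prescribed product: the pairing of \<open>\<phi>\<close> with \<open>a \<otimes> b\<close> is the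
  double sum of \<open>\<phi> (u \<otimes> v)\<close>, and an algebra law turns into the
  corresponding law of the monoid. This formula is proved for \<open>\<phi>\<close> with values in
  an arbitrary module, because the same formula shows that the linear extension of a monoid
  homomorphism is multiplicative.

  Every relation with a pseudo generator has one shape: some \<open>z\<close> carries a generator
  \<open>\<sigma>\<^sub>i\<close> to \<open>\<sigma>\<^sub>j\<close>, and has to carry the
  corresponding pseudo generator, or the inverse generator, along. For distant or equal indices this
  is commutation (\<open>i = j\<close> in the rule); in the sliding relations \<open>z\<close> is a
  product of two neighbouring generators, and the hypothesis on \<open>z\<close> is the braid
  relation.\<close>

lemma pres_eq_in_lists:
  assumes "pres_eq S Rel u v"
  shows "u \<in> lists S" and "v \<in> lists S"
  using assms by induction auto

text \<open>The hypothesis matters: a word with a letter outside \<open>S\<close> is related to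
  nothing, not even to itself, so all such words share the empty class.\<close>

lemma word_class_eq_iff:
  assumes "u \<in> lists S"
  shows "word_class S Rel u = word_class S Rel v \<longleftrightarrow> pres_eq S Rel u v"
proof
  assume "word_class S Rel u = word_class S Rel v"
  moreover have "u \<in> word_class S Rel u"
    using assms by (simp add: word_class_def pres_eq.refl)
  ultimately show "pres_eq S Rel u v"
    by (auto simp: word_class_def intro: pres_eq.sym)
qed (auto simp: word_class_def intro: pres_eq.sym pres_eq.trans)

text \<open>The product is a union over all representatives of both factors. By the congruence rule
  every choice gives the same class, and the index sets are nonempty, so the union
  collapses.\<close>

lemma word_class_mult:
  assumes "u \<in> lists S" and "v \<in> lists S"
  shows "word_class S Rel u \<otimes>\<^bsub>presented_monoid S Rel\<^esub> word_class S Rel v = word_class S Rel (u @ v)"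
proof -
  have "word_class S Rel (u' @ v') = word_class S Rel (u @ v)"
    if "u' \<in> word_class S Rel u" "v' \<in> word_class S Rel v" for u' v'
  proof -
    have "pres_eq S Rel (u @ v) (u' @ v')"
      using that by (simp add: word_class_def pres_eq.cong)
    then show ?thesis
      using assms word_class_eq_iff[of "u @ v" S Rel "u' @ v'"] by simp
  qed
  note same = this
  have "(\<Union>u'\<in>word_class S Rel u. \<Union>v'\<in>word_class S Rel v. word_class S Rel (u' @ v')) =
      (\<Union>u'\<in>word_class S Rel u. \<Union>v'\<in>word_class S Rel v. word_class S Rel (u @ v))"
    by (intro SUP_cong[OF HOL.refl] same)
  moreover have "u \<in> word_class S Rel u" "v \<in> word_class S Rel v"
    using assms by (simp_all add: word_class_def pres_eq.refl)
  ultimately show ?thesis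
    unfolding presented_monoid_def by auto
qed

lemma one_presented_monoid: "\<one>\<^bsub>presented_monoid S Rel\<^esub> = word_class S Rel []"
  by (simp add: presented_monoid_def)

lemma carrier_presented_monoid: "carrier (presented_monoid S Rel) = word_class S Rel ` lists S"
  by (simp add: presented_monoid_def)

lemma word_class_closed: "w \<in> lists S \<Longrightarrow> word_class S Rel w \<in> carrier (presented_monoid S Rel)"
  by (simp add: carrier_presented_monoid)

lemma presented_monoid_cases:
  assumes "U \<in> carrier (presented_monoid S Rel)"
  obtains w where "w \<in> lists S" and "U = word_class S Rel w"
  using assms by (auto simp: carrier_presented_monoid)

lemma monoid_presented_monoid: "Group.monoid (presented_monoid S Rel)"
  by (rule monoidI; (elim presented_monoid_cases)?)
    (simp_all add: one_presented_monoid word_class_mult word_class_closed)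

section \<open>Evaluation of words in a monoid\<close>

definition word_val :: "('a, 'x) monoid_scheme \<Rightarrow> ('g \<Rightarrow> 'a) \<Rightarrow> 'g list \<Rightarrow> 'a" where
  "word_val N \<phi> w = foldr (\<lambda>l x. \<phi> l \<otimes>\<^bsub>N\<^esub> x) w \<one>\<^bsub>N\<^esub>"

lemma word_val_simps [simp]:
  "word_val N \<phi> [] = \<one>\<^bsub>N\<^esub>"
  "word_val N \<phi> (l # w) = \<phi> l \<otimes>\<^bsub>N\<^esub> word_val N \<phi> w"
  by (simp_all add: word_val_def)

lemma word_val_closed:
  assumes "Group.monoid N" and "\<phi> \<in> S \<rightarrow> carrier N" and "w \<in> lists S"
  shows "word_val N \<phi> w \<in> carrier N"
  using assms(3)
proof induction
  case Nil
  then show ?case using assms(1) by simp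
next
  case (Cons l w)
  then show ?case using assms(1,2) by (auto intro: monoid.m_closed)
qed

lemma word_val_append:
  assumes N: "Group.monoid N" and \<phi>: "\<phi> \<in> S \<rightarrow> carrier N" and "u \<in> lists S" and v: "v \<in> lists S"
  shows "word_val N \<phi> (u @ v) = word_val N \<phi> u \<otimes>\<^bsub>N\<^esub> word_val N \<phi> v"
  using assms(3)
proof induction
  case Nil
  then show ?case using word_val_closed[OF N \<phi> v] N by simp
next
  case (Cons l w)
  then have "\<phi> l \<in> carrier N" using \<phi> by auto
  then show ?case
    using Cons word_val_closed[OF N \<phi>] v N by (simp add: monoid.m_assoc)
qed

lemma word_val_hom:
  assumes N: "Group.monoid N" and N': "Group.monoid N'" and \<phi>: "\<phi> \<in> S \<rightarrow> carrier N"
    and f: "f \<in> hom N N'" and one: "f \<one>\<^bsub>N\<^esub> = \<one>\<^bsub>N'\<^esub>" and "w \<in> lists S"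
  shows "f (word_val N \<phi> w) = word_val N' (f \<circ> \<phi>) w"
  using assms(6)
proof induction
  case (Cons l w)
  then show ?case
    using hom_mult[OF f, of "\<phi> l" "word_val N \<phi> w"] \<phi> word_val_closed[OF N \<phi>, of w] by auto
qed (simp add: one)

lemma word_val_word_class:
  assumes "w \<in> lists S"
  shows "word_val (presented_monoid S Rel) (\<lambda>l. word_class S Rel [l]) w = word_class S Rel w"
  using assms by induction (simp_all add: one_presented_monoid word_class_mult)

text \<open>On words over \<open>S\<close>, having equal values is a congruence, so it contains the
  least congruence generated by \<open>Rel\<close> as soon as it contains \<open>Rel\<close>.
  Membership in \<open>lists S\<close>, needed to split the value of a concatenation, comes from
  \<open>pres_eq_in_lists\<close>.\<close>

lemma word_val_pres_eq:
  assumes N: "Group.monoid N" and \<phi>: "\<phi> \<in> S \<rightarrow> carrier N"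
    and "\<And>u v. (u, v) \<in> Rel \<Longrightarrow> u \<in> lists S \<Longrightarrow> v \<in> lists S \<Longrightarrow> word_val N \<phi> u = word_val N \<phi> v"
    and "pres_eq S Rel u v"
  shows "word_val N \<phi> u = word_val N \<phi> v"
  using assms(4)
proof induction
  case (rel u v)
  then show ?case by (rule assms(3))
next
  case (cong u u' v v')
  then show ?case
    by (simp add: word_val_append[OF N \<phi>] pres_eq_in_lists[OF cong.hyps(1)]
        pres_eq_in_lists[OF cong.hyps(2)])
qed simp_all

text \<open>The universal property of a presentation: evaluation of words is constant on classes,
  hence descends to them.\<close>

lemma presented_monoid_hom_exists:
  assumes N: "Group.monoid N" and \<phi>: "\<phi> \<in> S \<rightarrow> carrier N"
    and rels: "\<And>u v. (u, v) \<in> Rel \<Longrightarrow> u \<in> lists S \<Longrightarrow> v \<in> lists S \<Longrightarrow>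
      word_val N \<phi> u = word_val N \<phi> v"
  obtains f where "f \<in> hom (presented_monoid S Rel) N" and "f \<one>\<^bsub>presented_monoid S Rel\<^esub> = \<one>\<^bsub>N\<^esub>"
    and "\<And>w. w \<in> lists S \<Longrightarrow> f (word_class S Rel w) = word_val N \<phi> w"
proof
  \<comment> \<open>Any representative would do; one exists because the class of a word over
    \<open>S\<close> contains that word.\<close>
  define f where "f U = word_val N \<phi> (SOME w. w \<in> U)" for U
  show f_class: "f (word_class S Rel w) = word_val N \<phi> w" if "w \<in> lists S" for w
  proof -
    have "w \<in> word_class S Rel w"
      using that by (simp add: word_class_def pres_eq.refl)
    then have "(SOME v. v \<in> word_class S Rel w) \<in> word_class S Rel w"
      by (rule someI)
    then have "pres_eq S Rel w (SOME v. v \<in> word_class S Rel w)"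
      by (simp add: word_class_def)
    from word_val_pres_eq[OF N \<phi> rels this] show ?thesis
      by (simp add: f_def)
  qed
  show "f \<one>\<^bsub>presented_monoid S Rel\<^esub> = \<one>\<^bsub>N\<^esub>"
    by (simp add: one_presented_monoid f_class)
  show "f \<in> hom (presented_monoid S Rel) N"
    by (rule homI; elim presented_monoid_cases)
      (simp_all add: word_class_mult f_class word_val_append[OF N \<phi>] word_val_closed[OF N \<phi>])
qed


subsection \<open>Finite sums and linear maps\<close>

text \<open>Stated for products in a commutative monoid, since the addition of an abelian monoid is
  an instance; the version for \<open>finsum\<close> is then only a renaming.\<close>

lemma (in comm_monoid) finprod_swap:
  assumes "finite A" and "finite B" and "\<And>i j. i \<in> A \<Longrightarrow> j \<in> B \<Longrightarrow> f i j \<in> carrier G"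
  shows "(\<Otimes>i\<in>A. \<Otimes>j\<in>B. f i j) = (\<Otimes>j\<in>B. \<Otimes>i\<in>A. f i j)"
  using assms(1,3)
proof induction
  case (insert a A)
  note closed = insert.prems
  have "(\<Otimes>i\<in>insert a A. \<Otimes>j\<in>B. f i j) = (\<Otimes>j\<in>B. f a j) \<otimes> (\<Otimes>i\<in>A. \<Otimes>j\<in>B. f i j)"
    using insert.hyps closed by (intro finprod_insert) (auto intro!: finprod_closed)
  also have "(\<Otimes>i\<in>A. \<Otimes>j\<in>B. f i j) = (\<Otimes>j\<in>B. \<Otimes>i\<in>A. f i j)"
    using closed by (intro insert.IH) auto
  also have "(\<Otimes>j\<in>B. f a j) \<otimes> \<dots> = (\<Otimes>j\<in>B. f a j \<otimes> (\<Otimes>i\<in>A. f i j))"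
    using closed by (intro finprod_multf[symmetric]) (auto intro!: finprod_closed)
  also have "\<dots> = (\<Otimes>j\<in>B. \<Otimes>i\<in>insert a A. f i j)"
  proof (rule finprod_cong')
    fix j assume "j \<in> B"
    then show "f a j \<otimes> (\<Otimes>i\<in>A. f i j) = (\<Otimes>i\<in>insert a A. f i j)"
      using insert.hyps closed by (intro finprod_insert[symmetric]) auto
  qed (use closed in \<open>auto intro!: finprod_closed\<close>)
  finally show ?case .
qed simp

lemma (in comm_monoid) finprod_Times:
  assumes "finite A" and "finite B" and "f \<in> A \<times> B \<rightarrow> carrier G"
  shows "finprod G f (A \<times> B) = (\<Otimes>i\<in>A. \<Otimes>j\<in>B. f (i, j))"
  using assms(1,3)
proof induction
  case (insert a A)
  have "insert a A \<times> B = Pair a ` B \<union> A \<times> B" by auto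
  then have "finprod G f (insert a A \<times> B) = finprod G f (Pair a ` B) \<otimes> finprod G f (A \<times> B)"
    using insert assms(2) by (simp add: finprod_Un_disjoint Pi_def disjoint_iff image_iff)
  also have "finprod G f (Pair a ` B) = (\<Otimes>j\<in>B. f (a, j))"
    using insert by (intro finprod_reindex) (auto simp: inj_on_def)
  finally have "finprod G f (insert a A \<times> B) =
      (\<Otimes>j\<in>B. f (a, j)) \<otimes> (\<Otimes>i\<in>A. \<Otimes>j\<in>B. f (i, j))"
    using insert by (simp add: Pi_def)
  then show ?case
    using insert by (subst finprod_insert) (auto intro!: finprod_closed)
qed simp

lemmas (in abelian_monoid) finsum_swap = add.finprod_swap
lemmas (in abelian_monoid) finsum_Times = add.finprod_Times
lemmas (in abelian_monoid) finsum_mono_neutral_cong_left = add.finprod_mono_neutral_cong_left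

definition linear_maps ::
    "('r, 'x) ring_scheme \<Rightarrow> ('r, 'a, 'y) module_scheme \<Rightarrow> ('r, 'b, 'z) module_scheme \<Rightarrow> ('a \<Rightarrow> 'b) set" where
  "linear_maps R M N = {f \<in> carrier M \<rightarrow> carrier N.
     (\<forall>a\<in>carrier M. \<forall>b\<in>carrier M. f (a \<oplus>\<^bsub>M\<^esub> b) = f a \<oplus>\<^bsub>N\<^esub> f b) \<and>
     (\<forall>c\<in>carrier R. \<forall>a\<in>carrier M. f (c \<odot>\<^bsub>M\<^esub> a) = c \<odot>\<^bsub>N\<^esub> f a)}"

text \<open>One exchange rule for all the linear maps that occur: multiplication by a fixed element,
  the pairing, the algebra homomorphisms and the trace.\<close>

lemma linear_map_finsum:
  assumes "module R M" and "module R N" and f: "f \<in> linear_maps R M N" and "g \<in> A \<rightarrow> carrier M"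
  shows "f (\<Oplus>\<^bsub>M\<^esub>i\<in>A. g i) = (\<Oplus>\<^bsub>N\<^esub>i\<in>A. f (g i))"
proof -
  interpret M: module R M by fact
  interpret N: module R N by fact
  have f_closed: "f x \<in> carrier N" if "x \<in> carrier M" for x
    using f that by (auto simp: linear_maps_def)
  \<comment> \<open>Preservation of zero is not part of \<open>linear_maps\<close>; it follows from
    homogeneity at the scalar zero.\<close>
  have zero: "f \<zero>\<^bsub>M\<^esub> = \<zero>\<^bsub>N\<^esub>"
  proof -
    have "f (\<zero>\<^bsub>R\<^esub> \<odot>\<^bsub>M\<^esub> \<zero>\<^bsub>M\<^esub>) = \<zero>\<^bsub>R\<^esub> \<odot>\<^bsub>N\<^esub> f \<zero>\<^bsub>M\<^esub>"
      using f M.M.zero_closed M.R.zero_closed unfolding linear_maps_def by blast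
    then show ?thesis
      using f_closed by simp
  qed
  show ?thesis
    using assms(4)
  proof (induction A rule: infinite_finite_induct)
    \<comment> \<open>Over an infinite index set both sums are zero by convention, so finiteness of
      \<open>A\<close> does not have to be assumed.\<close>
    case (infinite A)
    then show ?case by (simp add: zero)
  next
    case (insert a A)
    then have "f (g a \<oplus>\<^bsub>M\<^esub> (\<Oplus>\<^bsub>M\<^esub>i\<in>A. g i)) = f (g a) \<oplus>\<^bsub>N\<^esub> f (\<Oplus>\<^bsub>M\<^esub>i\<in>A. g i)"
      using f by (simp add: linear_maps_def)
    then show ?case
      using insert f_closed by (simp add: Pi_def)
  qed (simp add: zero)
qed

text \<open>A ring record has no scalar multiplication. Repackaging it as a module over itself makes
  linear forms a special case of linear maps.\<close>

definition regular_module :: "('r, 'x) ring_scheme \<Rightarrow> ('r, 'r) module" where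
  "regular_module R =
     \<lparr>carrier = carrier R, mult = mult R, one = one R, zero = zero R, add = add R, smult = mult R\<rparr>"

lemma regular_module_simps [simp]:
  "carrier (regular_module R) = carrier R"
  "add (regular_module R) = add R"
  "zero (regular_module R) = zero R"
  "smult (regular_module R) = mult R"
  by (simp_all add: regular_module_def)

lemma finsum_regular_module [simp]: "finsum (regular_module R) = finsum R"
  by (simp add: fun_eq_iff finsum_def finprod_def)

lemma (in cring) module_regular_module: "module R (regular_module R)"
proof (rule moduleI)
  have "\<exists>y\<in>carrier R. y \<oplus> x = \<zero>" if "x \<in> carrier R" for x
    using that l_neg by blast
  then show "abelian_group (regular_module R)"
    by (intro abelian_groupI) (simp_all add: a_ac)
next
  show "cring R" by (rule is_cring)
qed (auto intro: l_distr r_distr m_assoc)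

text \<open>The linear extension of a function given on basis elements. Summing over the support of
  \<open>a\<close> keeps the monoid out of the definition; with values in
  \<open>regular_module R\<close> it is the pairing of functions with formal sums.\<close>

definition lin_ext ::
    "('r, 'x) ring_scheme \<Rightarrow> ('r, 'a, 'y) module_scheme \<Rightarrow> ('m \<Rightarrow> 'a) \<Rightarrow> ('m \<Rightarrow> 'r) \<Rightarrow> 'a" where
  "lin_ext R N \<phi> a = (\<Oplus>\<^bsub>N\<^esub>m\<in>{m. a m \<noteq> \<zero>\<^bsub>R\<^esub>}. a m \<odot>\<^bsub>N\<^esub> \<phi> m)"

lemma lin_ext_superset:
  assumes "module R N" and "finite S" and "{m. a m \<noteq> \<zero>\<^bsub>R\<^esub>} \<subseteq> S"
    and "a \<in> S \<rightarrow> carrier R" and "\<phi> \<in> S \<rightarrow> carrier N"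
  shows "lin_ext R N \<phi> a = (\<Oplus>\<^bsub>N\<^esub>m\<in>S. a m \<odot>\<^bsub>N\<^esub> \<phi> m)"
proof -
  interpret N: module R N by fact
  show ?thesis
    unfolding lin_ext_def
    by (rule N.finsum_mono_neutral_cong_left) (use assms in \<open>auto simp: Pi_def\<close>)
qed

lemma linear_map_lin_ext:
  assumes N: "module R N" and N': "module R N'" and f: "f \<in> linear_maps R N N'"
    and "a \<in> {m. a m \<noteq> \<zero>\<^bsub>R\<^esub>} \<rightarrow> carrier R" and "\<phi> \<in> {m. a m \<noteq> \<zero>\<^bsub>R\<^esub>} \<rightarrow> carrier N"
  shows "f (lin_ext R N \<phi> a) = lin_ext R N' (f \<circ> \<phi>) a"
proof -
  interpret N: module R N by fact
  interpret N': module R N' by fact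
  have "f (lin_ext R N \<phi> a) = (\<Oplus>\<^bsub>N'\<^esub>m\<in>{m. a m \<noteq> \<zero>\<^bsub>R\<^esub>}. f (a m \<odot>\<^bsub>N\<^esub> \<phi> m))"
    unfolding lin_ext_def by (rule linear_map_finsum[OF N N' f]) (use assms in auto)
  also have "\<dots> = lin_ext R N' (f \<circ> \<phi>) a"
    unfolding lin_ext_def
    by (rule N'.finsum_cong') (use assms in \<open>auto simp: linear_maps_def Pi_def\<close>)
  finally show ?thesis .
qed

subsection \<open>Monoid algebras\<close>

locale monoid_algebra_setup = R: cring R + M: Group.monoid M
  for R :: "('r, 'x) ring_scheme" and M :: "('m, 'y) monoid_scheme"
begin

abbreviation alg :: "('r, 'm \<Rightarrow> 'r) module" where
  "alg \<equiv> monoid_algebra R M"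

definition supp :: "('m \<Rightarrow> 'r) \<Rightarrow> 'm set" where
  "supp a = {m. a m \<noteq> \<zero>\<^bsub>R\<^esub>}"

text \<open>Coefficients off \<open>carrier M\<close> are zero and hence lie in \<open>R\<close>, so
  closure can be stated for every argument, which spares case distinctions later.\<close>

lemma carrier_alg:
  "a \<in> carrier alg \<longleftrightarrow> finite (supp a) \<and> supp a \<subseteq> carrier M \<and> range a \<subseteq> carrier R"
proof -
  have "{m \<in> carrier M. a m \<noteq> \<zero>\<^bsub>R\<^esub>} = supp a" if "supp a \<subseteq> carrier M"
    using that by (auto simp: supp_def)
  moreover have "supp a \<subseteq> carrier M \<longleftrightarrow> (\<forall>m. m \<notin> carrier M \<longrightarrow> a m = \<zero>\<^bsub>R\<^esub>)"
    by (auto simp: supp_def)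
  moreover have "range a \<subseteq> carrier R \<longleftrightarrow> (\<forall>m\<in>carrier M. a m \<in> carrier R)"
    if "supp a \<subseteq> carrier M"
    using that by (force simp: supp_def)
  ultimately show ?thesis
    by (auto simp: monoid_algebra_def)
qed

lemma alg_closed:
  assumes "a \<in> carrier alg"
  shows "finite (supp a)" and "supp a \<subseteq> carrier M" and "a m \<in> carrier R"
    and "m \<in> supp a \<Longrightarrow> m \<in> carrier M"
  using assms unfolding carrier_alg by auto

lemma alg_apply:
  "(a \<oplus>\<^bsub>alg\<^esub> b) m = a m \<oplus>\<^bsub>R\<^esub> b m"
  "(c \<odot>\<^bsub>alg\<^esub> a) m = c \<otimes>\<^bsub>R\<^esub> a m"
  "\<zero>\<^bsub>alg\<^esub> m = \<zero>\<^bsub>R\<^esub>"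
  by (simp_all add: monoid_algebra_def)

lemma lin_ext_eq_finsum:
  assumes N: "module R N" and a: "a \<in> carrier alg" and \<phi>: "\<phi> \<in> carrier M \<rightarrow> carrier N"
    and "finite S" and "supp a \<subseteq> S" and "S \<subseteq> carrier M"
  shows "lin_ext R N \<phi> a = (\<Oplus>\<^bsub>N\<^esub>m\<in>S. a m \<odot>\<^bsub>N\<^esub> \<phi> m)"
  using assms alg_closed[OF a]
  by (intro lin_ext_superset) (auto simp: supp_def)

lemma lin_ext_closed:
  assumes N: "module R N" and a: "a \<in> carrier alg" and \<phi>: "\<phi> \<in> carrier M \<rightarrow> carrier N"
  shows "lin_ext R N \<phi> a \<in> carrier N"
proof -
  interpret N: module R N by fact
  show ?thesis
    unfolding lin_ext_def
    by (rule N.finsum_closed) (use alg_closed[OF a] \<phi> in \<open>auto simp: supp_def Pi_def\<close>)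
qed

lemma lin_ext_cong:
  assumes N: "module R N" and a: "a \<in> carrier alg" and \<phi>: "\<phi> \<in> carrier M \<rightarrow> carrier N"
    and "\<And>m. m \<in> carrier M \<Longrightarrow> \<psi> m = \<phi> m"
  shows "lin_ext R N \<psi> a = lin_ext R N \<phi> a"
proof -
  interpret N: module R N by fact
  show ?thesis
    unfolding lin_ext_def
    by (rule N.finsum_cong') (use alg_closed[OF a] assms(4) \<phi> in \<open>auto simp: supp_def Pi_def\<close>)
qed

lemma alg_add_closed:
  assumes "a \<in> carrier alg" and "b \<in> carrier alg"
  shows "a \<oplus>\<^bsub>alg\<^esub> b \<in> carrier alg"
proof -
  have "supp (a \<oplus>\<^bsub>alg\<^esub> b) \<subseteq> supp a \<union> supp b"
    by (auto simp: supp_def alg_apply)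
  then show ?thesis
    using alg_closed[OF assms(1)] alg_closed[OF assms(2)]
    by (auto simp: carrier_alg alg_apply intro: finite_subset)
qed

lemma alg_smult_closed:
  assumes "c \<in> carrier R" and "a \<in> carrier alg"
  shows "c \<odot>\<^bsub>alg\<^esub> a \<in> carrier alg"
proof -
  have "supp (c \<odot>\<^bsub>alg\<^esub> a) \<subseteq> supp a"
    using assms(1) by (auto simp: supp_def alg_apply)
  then show ?thesis
    using alg_closed[OF assms(2)] assms(1)
    by (auto simp: carrier_alg alg_apply intro: finite_subset)
qed

lemma basis_elem_closed:
  assumes "m \<in> carrier M"
  shows "basis_elem R m \<in> carrier alg"
proof -
  have "supp (basis_elem R m) \<subseteq> {m}"
    by (auto simp: supp_def basis_elem_def)
  then show ?thesis
    using assms by (auto simp: carrier_alg basis_elem_def intro: finite_subset)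
qed

lemma one_alg: "\<one>\<^bsub>alg\<^esub> = basis_elem R \<one>\<^bsub>M\<^esub>"
  by (simp add: monoid_algebra_def basis_elem_def)

lemma alg_one_closed: "\<one>\<^bsub>alg\<^esub> \<in> carrier alg"
  by (simp add: one_alg basis_elem_closed)

text \<open>Replaces the index set in the definition of the product, which depends on
  \<open>m\<close>, by a fixed finite set with zero terms. Only in this form can the sum be
  interchanged with a sum over \<open>m\<close>.\<close>

lemma alg_mult_supp:
  assumes "a \<in> carrier alg" and "b \<in> carrier alg"
  shows "(a \<otimes>\<^bsub>alg\<^esub> b) m =
    (\<Oplus>\<^bsub>R\<^esub>p\<in>supp a \<times> supp b.
       if fst p \<otimes>\<^bsub>M\<^esub> snd p = m then a (fst p) \<otimes>\<^bsub>R\<^esub> b (snd p) else \<zero>\<^bsub>R\<^esub>)"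
proof -
  have "finite (supp a \<times> supp b)"
    using alg_closed assms by blast
  then show ?thesis
    unfolding monoid_algebra_def monoid.simps
    by (intro R.finsum_mono_neutral_cong_left)
      (use alg_closed[OF assms(1)] alg_closed[OF assms(2)] in \<open>auto simp: supp_def\<close>)
qed

lemma alg_mult_supp_subset:
  assumes "a \<in> carrier alg" and "b \<in> carrier alg"
  shows "supp (a \<otimes>\<^bsub>alg\<^esub> b) \<subseteq> (\<lambda>p. fst p \<otimes>\<^bsub>M\<^esub> snd p) ` (supp a \<times> supp b)"
proof
  fix m assume "m \<in> supp (a \<otimes>\<^bsub>alg\<^esub> b)"
  then have "(\<Oplus>\<^bsub>R\<^esub>p\<in>supp a \<times> supp b.
      if fst p \<otimes>\<^bsub>M\<^esub> snd p = m then a (fst p) \<otimes>\<^bsub>R\<^esub> b (snd p) else \<zero>\<^bsub>R\<^esub>) \<noteq> \<zero>\<^bsub>R\<^esub>"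
    using alg_mult_supp[OF assms] by (simp add: supp_def)
  then have "\<exists>p\<in>supp a \<times> supp b. fst p \<otimes>\<^bsub>M\<^esub> snd p = m"
    by (rule contrapos_np) (rule R.add.finprod_one_eqI, rule if_not_P, blast)
  then show "m \<in> (\<lambda>p. fst p \<otimes>\<^bsub>M\<^esub> snd p) ` (supp a \<times> supp b)"
    unfolding image_def by blast
qed

lemma alg_mult_closed:
  assumes "a \<in> carrier alg" and "b \<in> carrier alg"
  shows "a \<otimes>\<^bsub>alg\<^esub> b \<in> carrier alg"
  unfolding carrier_alg
proof (intro conjI)
  note a = alg_closed[OF assms(1)] and b = alg_closed[OF assms(2)]
  show "finite (supp (a \<otimes>\<^bsub>alg\<^esub> b))"
    using a b by (intro finite_subset[OF alg_mult_supp_subset[OF assms]]) auto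
  show "supp (a \<otimes>\<^bsub>alg\<^esub> b) \<subseteq> carrier M"
    using a b by (intro subset_trans[OF alg_mult_supp_subset[OF assms]]) (auto simp: subset_iff)
  show "range (a \<otimes>\<^bsub>alg\<^esub> b) \<subseteq> carrier R"
    using a b by (auto simp: alg_mult_supp[OF assms] intro!: R.finsum_closed)
qed

text \<open>Convolution is dual to multiplication in \<open>M\<close>. Interchanging the sum over
  \<open>m\<close> with the sum over pairs leaves, for each pair, the single term at its
  product.\<close>

lemma lin_ext_mult:
  assumes N: "module R N" and a: "a \<in> carrier alg" and b: "b \<in> carrier alg"
    and \<phi>: "\<phi> \<in> carrier M \<rightarrow> carrier N"
  shows "lin_ext R N \<phi> (a \<otimes>\<^bsub>alg\<^esub> b) = lin_ext R N (\<lambda>u. lin_ext R N (\<lambda>v. \<phi> (u \<otimes>\<^bsub>M\<^esub> v)) b) a"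
proof -
  interpret N: module R N by fact
  note ca = alg_closed[OF a] and cb = alg_closed[OF b]
  \<comment> \<open>A finite set containing the support of the product, over which the coefficients
    can be expanded.\<close>
  define P where "P = (\<lambda>p. fst p \<otimes>\<^bsub>M\<^esub> snd p) ` (supp a \<times> supp b)"
  define g where "g m p =
    (if fst p \<otimes>\<^bsub>M\<^esub> snd p = m then a (fst p) \<otimes>\<^bsub>R\<^esub> b (snd p) else \<zero>\<^bsub>R\<^esub>)" for m p
  have P: "finite P" "P \<subseteq> carrier M"
    using ca cb by (auto simp: P_def subset_iff)
  have g: "g m p \<in> carrier R" for m p
    using ca cb by (simp add: g_def)
  have ab: "(a \<otimes>\<^bsub>alg\<^esub> b) m = (\<Oplus>\<^bsub>R\<^esub>p\<in>supp a \<times> supp b. g m p)" for m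
    by (simp add: alg_mult_supp[OF a b] g_def)
  \<comment> \<open>For fixed \<open>x\<close> the action on \<open>x\<close> is linear in the
    scalar, so it passes through a sum of scalars.\<close>
  have sum_l: "(\<Oplus>\<^bsub>R\<^esub>p\<in>S. g m p) \<odot>\<^bsub>N\<^esub> x = (\<Oplus>\<^bsub>N\<^esub>p\<in>S. g m p \<odot>\<^bsub>N\<^esub> x)"
    if "x \<in> carrier N" for x m S
  proof -
    have "(\<lambda>c. c \<odot>\<^bsub>N\<^esub> x) \<in> linear_maps R (regular_module R) N"
      using that by (auto simp: linear_maps_def N.smult_l_distr N.smult_assoc1)
    from linear_map_finsum[OF R.module_regular_module N this, of "g m" S] show ?thesis
      using g by simp
  qed
  have "lin_ext R N \<phi> (a \<otimes>\<^bsub>alg\<^esub> b) = (\<Oplus>\<^bsub>N\<^esub>m\<in>P. (a \<otimes>\<^bsub>alg\<^esub> b) m \<odot>\<^bsub>N\<^esub> \<phi> m)"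
    using alg_mult_supp_subset[OF a b] P
    by (intro lin_ext_eq_finsum[OF N alg_mult_closed[OF a b] \<phi>]) (auto simp: P_def)
  also have "\<dots> = (\<Oplus>\<^bsub>N\<^esub>m\<in>P. \<Oplus>\<^bsub>N\<^esub>p\<in>supp a \<times> supp b. g m p \<odot>\<^bsub>N\<^esub> \<phi> m)"
    using P \<phi> g
    by (intro N.finsum_cong') (auto simp: ab sum_l subset_iff Pi_def intro!: N.finsum_closed)
  also have "\<dots> = (\<Oplus>\<^bsub>N\<^esub>p\<in>supp a \<times> supp b. \<Oplus>\<^bsub>N\<^esub>m\<in>P. g m p \<odot>\<^bsub>N\<^esub> \<phi> m)"
    using P \<phi> g ca cb by (intro N.finsum_swap) (auto simp: subset_iff Pi_def)
  also have "\<dots> = (\<Oplus>\<^bsub>N\<^esub>p\<in>supp a \<times> supp b.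
      (a (fst p) \<otimes>\<^bsub>R\<^esub> b (snd p)) \<odot>\<^bsub>N\<^esub> \<phi> (fst p \<otimes>\<^bsub>M\<^esub> snd p))"
  proof (rule N.finsum_cong'[OF HOL.refl])
    \<comment> \<open>For a fixed pair only its own product contributes to the sum over
      \<open>P\<close>.\<close>
    fix p assume p: "p \<in> supp a \<times> supp b"
    then have "fst p \<otimes>\<^bsub>M\<^esub> snd p \<in> P" by (auto simp: P_def)
    have "(\<Oplus>\<^bsub>N\<^esub>m\<in>P. g m p \<odot>\<^bsub>N\<^esub> \<phi> m) =
        (\<Oplus>\<^bsub>N\<^esub>m\<in>P. if fst p \<otimes>\<^bsub>M\<^esub> snd p = m
          then (a (fst p) \<otimes>\<^bsub>R\<^esub> b (snd p)) \<odot>\<^bsub>N\<^esub> \<phi> m else \<zero>\<^bsub>N\<^esub>)"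
      using P \<phi> ca cb by (intro N.finsum_cong') (auto simp: g_def subset_iff Pi_def)
    also have "\<dots> = (a (fst p) \<otimes>\<^bsub>R\<^esub> b (snd p)) \<odot>\<^bsub>N\<^esub> \<phi> (fst p \<otimes>\<^bsub>M\<^esub> snd p)"
      using P \<phi> ca cb \<open>fst p \<otimes>\<^bsub>M\<^esub> snd p \<in> P\<close>
      by (intro N.finsum_singleton) (auto simp: subset_iff Pi_def)
    finally show "(\<Oplus>\<^bsub>N\<^esub>m\<in>P. g m p \<odot>\<^bsub>N\<^esub> \<phi> m) =
      (a (fst p) \<otimes>\<^bsub>R\<^esub> b (snd p)) \<odot>\<^bsub>N\<^esub> \<phi> (fst p \<otimes>\<^bsub>M\<^esub> snd p)" .
  qed (use \<phi> ca cb in \<open>auto simp: Pi_def\<close>)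
  also have "\<dots> = (\<Oplus>\<^bsub>N\<^esub>u\<in>supp a. \<Oplus>\<^bsub>N\<^esub>v\<in>supp b.
      (a u \<otimes>\<^bsub>R\<^esub> b v) \<odot>\<^bsub>N\<^esub> \<phi> (u \<otimes>\<^bsub>M\<^esub> v))"
    using \<phi> ca cb by (subst N.finsum_Times) (auto simp: Pi_def)
  also have "\<dots> = (\<Oplus>\<^bsub>N\<^esub>u\<in>supp a. a u \<odot>\<^bsub>N\<^esub> (\<Oplus>\<^bsub>N\<^esub>v\<in>supp b. b v \<odot>\<^bsub>N\<^esub> \<phi> (u \<otimes>\<^bsub>M\<^esub> v)))"
  proof (rule N.finsum_cong'[OF HOL.refl])
    fix u assume "u \<in> supp a"
    then have "u \<in> carrier M" using ca by auto
    then have "a u \<odot>\<^bsub>N\<^esub> (\<Oplus>\<^bsub>N\<^esub>v\<in>supp b. b v \<odot>\<^bsub>N\<^esub> \<phi> (u \<otimes>\<^bsub>M\<^esub> v)) =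
        (\<Oplus>\<^bsub>N\<^esub>v\<in>supp b. a u \<odot>\<^bsub>N\<^esub> (b v \<odot>\<^bsub>N\<^esub> \<phi> (u \<otimes>\<^bsub>M\<^esub> v)))"
      using \<phi> ca cb by (intro N.finsum_smult_ldistr) (auto simp: Pi_def)
    also have "\<dots> = (\<Oplus>\<^bsub>N\<^esub>v\<in>supp b. (a u \<otimes>\<^bsub>R\<^esub> b v) \<odot>\<^bsub>N\<^esub> \<phi> (u \<otimes>\<^bsub>M\<^esub> v))"
      using \<phi> ca cb \<open>u \<in> carrier M\<close>
      by (intro N.finsum_cong') (auto simp: N.smult_assoc1 subset_iff Pi_def)
    finally show "(\<Oplus>\<^bsub>N\<^esub>v\<in>supp b. (a u \<otimes>\<^bsub>R\<^esub> b v) \<odot>\<^bsub>N\<^esub> \<phi> (u \<otimes>\<^bsub>M\<^esub> v)) =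
      a u \<odot>\<^bsub>N\<^esub> (\<Oplus>\<^bsub>N\<^esub>v\<in>supp b. b v \<odot>\<^bsub>N\<^esub> \<phi> (u \<otimes>\<^bsub>M\<^esub> v))" by simp
  qed (use \<phi> ca cb in \<open>auto simp: Pi_def intro!: N.finsum_closed\<close>)
  finally show ?thesis
    by (simp add: lin_ext_def supp_def)
qed

lemma lin_ext_add:
  assumes N: "module R N" and a: "a \<in> carrier alg" and b: "b \<in> carrier alg"
    and \<phi>: "\<phi> \<in> carrier M \<rightarrow> carrier N"
  shows "lin_ext R N \<phi> (a \<oplus>\<^bsub>alg\<^esub> b) = lin_ext R N \<phi> a \<oplus>\<^bsub>N\<^esub> lin_ext R N \<phi> b"
proof -
  interpret N: module R N by fact
  note ca = alg_closed[OF a] and cb = alg_closed[OF b]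
  define S where "S = supp a \<union> supp b"
  have S: "finite S" "S \<subseteq> carrier M" "supp a \<subseteq> S" "supp b \<subseteq> S"
    using ca cb by (auto simp: S_def)
  have ab: "supp (a \<oplus>\<^bsub>alg\<^esub> b) \<subseteq> S"
    by (auto simp: S_def supp_def alg_apply)
  have "lin_ext R N \<phi> (a \<oplus>\<^bsub>alg\<^esub> b) = (\<Oplus>\<^bsub>N\<^esub>m\<in>S. (a \<oplus>\<^bsub>alg\<^esub> b) m \<odot>\<^bsub>N\<^esub> \<phi> m)"
    by (rule lin_ext_eq_finsum[OF N alg_add_closed[OF a b] \<phi> S(1) ab S(2)])
  also have "\<dots> = (\<Oplus>\<^bsub>N\<^esub>m\<in>S. a m \<odot>\<^bsub>N\<^esub> \<phi> m \<oplus>\<^bsub>N\<^esub> b m \<odot>\<^bsub>N\<^esub> \<phi> m)"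
    using S \<phi> ca cb
    by (intro N.finsum_cong') (auto simp: alg_apply N.smult_l_distr subset_iff Pi_def)
  also have "\<dots> = (\<Oplus>\<^bsub>N\<^esub>m\<in>S. a m \<odot>\<^bsub>N\<^esub> \<phi> m) \<oplus>\<^bsub>N\<^esub> (\<Oplus>\<^bsub>N\<^esub>m\<in>S. b m \<odot>\<^bsub>N\<^esub> \<phi> m)"
    using S \<phi> ca cb by (intro N.finsum_addf) (auto simp: subset_iff Pi_def)
  finally show ?thesis
    using S by (simp add: lin_ext_eq_finsum[OF N a \<phi>, of S] lin_ext_eq_finsum[OF N b \<phi>, of S])
qed

lemma lin_ext_smult:
  assumes N: "module R N" and c: "c \<in> carrier R" and a: "a \<in> carrier alg"
    and \<phi>: "\<phi> \<in> carrier M \<rightarrow> carrier N"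
  shows "lin_ext R N \<phi> (c \<odot>\<^bsub>alg\<^esub> a) = c \<odot>\<^bsub>N\<^esub> lin_ext R N \<phi> a"
proof -
  interpret N: module R N by fact
  note ca = alg_closed[OF a]
  have ac: "supp (c \<odot>\<^bsub>alg\<^esub> a) \<subseteq> supp a"
    using c by (auto simp: supp_def alg_apply)
  have "lin_ext R N \<phi> (c \<odot>\<^bsub>alg\<^esub> a) = (\<Oplus>\<^bsub>N\<^esub>m\<in>supp a. (c \<odot>\<^bsub>alg\<^esub> a) m \<odot>\<^bsub>N\<^esub> \<phi> m)"
    by (rule lin_ext_eq_finsum[OF N alg_smult_closed[OF c a] \<phi> ca(1) ac ca(2)])
  also have "\<dots> = (\<Oplus>\<^bsub>N\<^esub>m\<in>supp a. c \<odot>\<^bsub>N\<^esub> (a m \<odot>\<^bsub>N\<^esub> \<phi> m))"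
    using \<phi> ca c
    by (intro N.finsum_cong') (auto simp: alg_apply N.smult_assoc1 subset_iff Pi_def)
  also have "\<dots> = c \<odot>\<^bsub>N\<^esub> (\<Oplus>\<^bsub>N\<^esub>m\<in>supp a. a m \<odot>\<^bsub>N\<^esub> \<phi> m)"
    using \<phi> ca c by (intro N.finsum_smult_ldistr[symmetric]) (auto simp: Pi_def)
  finally show ?thesis
    by (simp add: lin_ext_def supp_def)
qed

lemma lin_ext_basis_elem:
  assumes N: "module R N" and m: "m \<in> carrier M" and \<phi>: "\<phi> \<in> carrier M \<rightarrow> carrier N"
  shows "lin_ext R N \<phi> (basis_elem R m) = \<phi> m"
proof -
  interpret N: module R N by fact
  have "supp (basis_elem R m) \<subseteq> {m}"
    by (auto simp: basis_elem_def supp_def)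
  then have "lin_ext R N \<phi> (basis_elem R m) = (\<Oplus>\<^bsub>N\<^esub>x\<in>{m}. basis_elem R m x \<odot>\<^bsub>N\<^esub> \<phi> x)"
    using m by (intro lin_ext_eq_finsum[OF N basis_elem_closed[OF m] \<phi>]) auto
  also have "\<dots> = \<phi> m"
    using funcset_mem[OF \<phi> m] by (simp add: basis_elem_def)
  finally show ?thesis .
qed

text \<open>Pairing with the indicator \<open>basis_elem R m\<close> recovers the coefficient at
  \<open>m\<close>, so functions on the monoid separate elements; off the carrier both coefficients
  vanish.\<close>

lemma alg_eqI:
  assumes a: "a \<in> carrier alg" and b: "b \<in> carrier alg"
    and eq: "\<And>\<phi>. \<phi> \<in> carrier M \<rightarrow> carrier R \<Longrightarrow>
      lin_ext R (regular_module R) \<phi> a = lin_ext R (regular_module R) \<phi> b"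
  shows "a = b"
proof
  fix m
  have coeff: "lin_ext R (regular_module R) (basis_elem R m) a = a m"
    if "a \<in> carrier alg" "m \<in> carrier M" for a
  proof -
    note ca = alg_closed[OF that(1)]
    have "lin_ext R (regular_module R) (basis_elem R m) a =
        (\<Oplus>\<^bsub>R\<^esub>x\<in>insert m (supp a). a x \<otimes>\<^bsub>R\<^esub> basis_elem R m x)"
      using lin_ext_eq_finsum[OF R.module_regular_module that(1), of "basis_elem R m" "insert m (supp a)"]
        ca that(2) by (auto simp: basis_elem_def)
    also have "\<dots> = (\<Oplus>\<^bsub>R\<^esub>x\<in>insert m (supp a). if m = x then a x else \<zero>\<^bsub>R\<^esub>)"
      using ca by (intro R.finsum_cong') (auto simp: basis_elem_def)
    also have "\<dots> = a m"
      using ca by (intro R.finsum_singleton) auto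
    finally show ?thesis .
  qed
  show "a m = b m"
  proof (cases "m \<in> carrier M")
    case True
    have "basis_elem R m \<in> carrier M \<rightarrow> carrier R"
      by (simp add: basis_elem_def)
    from eq[OF this] show ?thesis
      using coeff[OF a True] coeff[OF b True] by simp
  next
    case False
    then have "m \<notin> supp a" "m \<notin> supp b"
      using alg_closed(2)[OF a] alg_closed(2)[OF b] by auto
    then show ?thesis
      by (simp add: supp_def)
  qed
qed

end

text \<open>Not necessarily commutative, unlike the locale \<^locale>\<open>algebra\<close>.\<close>

locale assoc_algebra = module R A + A?: ring A for R (structure) and A :: "('r, 'a) module" +
  assumes smult_mult_l: "\<lbrakk>c \<in> carrier R; x \<in> carrier A; y \<in> carrier A\<rbrakk> \<Longrightarrow>
      (c \<odot>\<^bsub>A\<^esub> x) \<otimes>\<^bsub>A\<^esub> y = c \<odot>\<^bsub>A\<^esub> (x \<otimes>\<^bsub>A\<^esub> y)"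
    and smult_mult_r: "\<lbrakk>c \<in> carrier R; x \<in> carrier A; y \<in> carrier A\<rbrakk> \<Longrightarrow>
      x \<otimes>\<^bsub>A\<^esub> (c \<odot>\<^bsub>A\<^esub> y) = c \<odot>\<^bsub>A\<^esub> (x \<otimes>\<^bsub>A\<^esub> y)"

section \<open>The algebra laws, tested by the pairing\<close>

context monoid_algebra_setup
begin

abbreviation pairing :: "('m \<Rightarrow> 'r) \<Rightarrow> ('m \<Rightarrow> 'r) \<Rightarrow> 'r" where
  "pairing \<phi> a \<equiv> lin_ext R (regular_module R) \<phi> a"

lemmas reg = R.module_regular_module

lemma pairing_closed:
  assumes "\<phi> \<in> carrier M \<rightarrow> carrier R" and "a \<in> carrier alg"
  shows "pairing \<phi> a \<in> carrier R"
  using lin_ext_closed[OF reg assms(2)] assms(1) by simp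

text \<open>Linearity in the function instead of the element: after \<open>lin_ext_mult\<close> the
  right factor of a product sits inside the function.\<close>

lemma lin_ext_fun_add:
  assumes N: "module R N" and a: "a \<in> carrier alg"
    and "\<phi> \<in> carrier M \<rightarrow> carrier N" and "\<psi> \<in> carrier M \<rightarrow> carrier N"
  shows "lin_ext R N (\<lambda>m. \<phi> m \<oplus>\<^bsub>N\<^esub> \<psi> m) a = lin_ext R N \<phi> a \<oplus>\<^bsub>N\<^esub> lin_ext R N \<psi> a"
proof -
  interpret N: module R N by fact
  note ca = alg_closed[OF a]
  have "lin_ext R N (\<lambda>m. \<phi> m \<oplus>\<^bsub>N\<^esub> \<psi> m) a = (\<Oplus>\<^bsub>N\<^esub>m\<in>supp a. a m \<odot>\<^bsub>N\<^esub> \<phi> m \<oplus>\<^bsub>N\<^esub> a m \<odot>\<^bsub>N\<^esub> \<psi> m)"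
    unfolding lin_ext_def supp_def[symmetric]
    using ca assms(3,4) by (intro N.finsum_cong') (auto simp: N.smult_r_distr Pi_def)
  also have "\<dots> = lin_ext R N \<phi> a \<oplus>\<^bsub>N\<^esub> lin_ext R N \<psi> a"
    unfolding lin_ext_def supp_def[symmetric]
    using ca assms(3,4) by (intro N.finsum_addf) (auto simp: Pi_def)
  finally show ?thesis .
qed

text \<open>Since \<open>R\<close> is commutative, multiplication by \<open>c\<close> is itself a
  linear map of \<open>N\<close>, so it passes through the extension.\<close>

lemma lin_ext_fun_smult:
  assumes N: "module R N" and a: "a \<in> carrier alg" and c: "c \<in> carrier R"
    and \<phi>: "\<phi> \<in> carrier M \<rightarrow> carrier N"
  shows "lin_ext R N (\<lambda>m. c \<odot>\<^bsub>N\<^esub> \<phi> m) a = c \<odot>\<^bsub>N\<^esub> lin_ext R N \<phi> a"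
proof -
  interpret N: module R N by fact
  have "(\<odot>\<^bsub>N\<^esub>) c \<in> linear_maps R N N"
    using c by (auto simp: linear_maps_def N.smult_r_distr R.m_comm simp flip: N.smult_assoc1)
  from linear_map_lin_ext[OF N N this, of a \<phi>] show ?thesis
    using alg_closed[OF a] \<phi> by (auto simp: o_def supp_def Pi_def)
qed

text \<open>After pairing, both sides are triple sums of values of \<open>\<phi>\<close> at a
  product of three monoid elements, and they differ only in the bracketing inside
  \<open>M\<close>.\<close>

lemma alg_mult_assoc:
  assumes a: "a \<in> carrier alg" and b: "b \<in> carrier alg" and c: "c \<in> carrier alg"
  shows "(a \<otimes>\<^bsub>alg\<^esub> b) \<otimes>\<^bsub>alg\<^esub> c = a \<otimes>\<^bsub>alg\<^esub> (b \<otimes>\<^bsub>alg\<^esub> c)"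
proof (rule alg_eqI)
  fix \<phi> assume \<phi>: "\<phi> \<in> carrier M \<rightarrow> carrier R"
  note * = pairing_closed
  have "pairing \<phi> ((a \<otimes>\<^bsub>alg\<^esub> b) \<otimes>\<^bsub>alg\<^esub> c) =
      pairing (\<lambda>u. pairing (\<lambda>v. pairing (\<lambda>w. \<phi> ((u \<otimes>\<^bsub>M\<^esub> v) \<otimes>\<^bsub>M\<^esub> w)) c) b) a"
    using a b c \<phi> * by (simp add: lin_ext_mult[OF reg] alg_mult_closed Pi_def)
  also have "\<dots> = pairing (\<lambda>u. pairing (\<lambda>v. pairing (\<lambda>w. \<phi> (u \<otimes>\<^bsub>M\<^esub> (v \<otimes>\<^bsub>M\<^esub> w))) c) b) a"
    using a b c \<phi> by (intro lin_ext_cong[OF reg]) (auto simp: M.m_assoc Pi_def intro!: *)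
  also have "\<dots> = pairing (\<lambda>u. pairing (\<lambda>x. \<phi> (u \<otimes>\<^bsub>M\<^esub> x)) (b \<otimes>\<^bsub>alg\<^esub> c)) a"
  proof (rule lin_ext_cong[OF reg a])
    fix u assume "u \<in> carrier M"
    then show "pairing (\<lambda>v. pairing (\<lambda>w. \<phi> (u \<otimes>\<^bsub>M\<^esub> (v \<otimes>\<^bsub>M\<^esub> w))) c) b =
        pairing (\<lambda>x. \<phi> (u \<otimes>\<^bsub>M\<^esub> x)) (b \<otimes>\<^bsub>alg\<^esub> c)"
      using \<phi> by (intro lin_ext_mult[OF reg b c, symmetric]) auto
  qed (use \<phi> b c in \<open>auto intro!: * alg_mult_closed\<close>)
  also have "\<dots> = pairing \<phi> (a \<otimes>\<^bsub>alg\<^esub> (b \<otimes>\<^bsub>alg\<^esub> c))"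
    using a b c \<phi> by (intro lin_ext_mult[OF reg, symmetric]) (auto intro: alg_mult_closed)
  finally show "pairing \<phi> ((a \<otimes>\<^bsub>alg\<^esub> b) \<otimes>\<^bsub>alg\<^esub> c) = pairing \<phi> (a \<otimes>\<^bsub>alg\<^esub> (b \<otimes>\<^bsub>alg\<^esub> c))" .
qed (use a b c in \<open>auto intro: alg_mult_closed\<close>)

lemma alg_monoid: "Group.monoid alg"
proof (rule monoidI)
  fix a assume a: "a \<in> carrier alg"
  show "\<one>\<^bsub>alg\<^esub> \<otimes>\<^bsub>alg\<^esub> a = a"
  proof (rule alg_eqI)
    fix \<phi> assume \<phi>: "\<phi> \<in> carrier M \<rightarrow> carrier R"
    have "pairing \<phi> (\<one>\<^bsub>alg\<^esub> \<otimes>\<^bsub>alg\<^esub> a) = pairing (\<lambda>v. \<phi> (\<one>\<^bsub>M\<^esub> \<otimes>\<^bsub>M\<^esub> v)) a"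
    proof -
      have "pairing \<phi> (\<one>\<^bsub>alg\<^esub> \<otimes>\<^bsub>alg\<^esub> a) =
          pairing (\<lambda>u. pairing (\<lambda>v. \<phi> (u \<otimes>\<^bsub>M\<^esub> v)) a) (basis_elem R \<one>\<^bsub>M\<^esub>)"
        using \<phi> one_alg lin_ext_mult[OF reg alg_one_closed a] by simp
      also have "\<dots> = pairing (\<lambda>v. \<phi> (\<one>\<^bsub>M\<^esub> \<otimes>\<^bsub>M\<^esub> v)) a"
        using \<phi> by (intro lin_ext_basis_elem[OF reg]) (auto intro!: pairing_closed a)
      finally show ?thesis .
    qed
    also have "\<dots> = pairing \<phi> a"
      using a \<phi> by (intro lin_ext_cong[OF reg]) auto
    finally show "pairing \<phi> (\<one>\<^bsub>alg\<^esub> \<otimes>\<^bsub>alg\<^esub> a) = pairing \<phi> a" .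
  qed (use a in \<open>auto intro: alg_mult_closed alg_one_closed\<close>)
  show "a \<otimes>\<^bsub>alg\<^esub> \<one>\<^bsub>alg\<^esub> = a"
  proof (rule alg_eqI)
    fix \<phi> assume \<phi>: "\<phi> \<in> carrier M \<rightarrow> carrier R"
    have "pairing \<phi> (a \<otimes>\<^bsub>alg\<^esub> \<one>\<^bsub>alg\<^esub>) = pairing (\<lambda>u. pairing (\<lambda>v. \<phi> (u \<otimes>\<^bsub>M\<^esub> v)) \<one>\<^bsub>alg\<^esub>) a"
      using \<phi> by (intro lin_ext_mult[OF reg a alg_one_closed]) auto
    also have "\<dots> = pairing \<phi> a"
    proof (rule lin_ext_cong[OF reg a])
      fix u assume u: "u \<in> carrier M"
      have "pairing (\<lambda>v. \<phi> (u \<otimes>\<^bsub>M\<^esub> v)) \<one>\<^bsub>alg\<^esub> = \<phi> (u \<otimes>\<^bsub>M\<^esub> \<one>\<^bsub>M\<^esub>)"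
        unfolding one_alg using u \<phi> by (intro lin_ext_basis_elem[OF reg]) auto
      then show "pairing (\<lambda>v. \<phi> (u \<otimes>\<^bsub>M\<^esub> v)) \<one>\<^bsub>alg\<^esub> = \<phi> u"
        using u by simp
    qed (use \<phi> in auto)
    finally show "pairing \<phi> (a \<otimes>\<^bsub>alg\<^esub> \<one>\<^bsub>alg\<^esub>) = pairing \<phi> a" .
  qed (use a in \<open>auto intro: alg_mult_closed alg_one_closed\<close>)
qed (auto intro: alg_mult_closed alg_one_closed alg_mult_assoc)

lemma alg_abelian_group: "abelian_group alg"
proof (rule abelian_groupI)
  show "\<zero>\<^bsub>alg\<^esub> \<in> carrier alg"
    by (simp add: carrier_alg supp_def alg_apply image_subset_iff)
  fix a assume a: "a \<in> carrier alg"
  \<comment> \<open>The negative is taken as a scalar multiple, so that its membership in the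
    carrier is already known.\<close>
  show "\<exists>b\<in>carrier alg. b \<oplus>\<^bsub>alg\<^esub> a = \<zero>\<^bsub>alg\<^esub>"
  proof
    show "(\<ominus>\<^bsub>R\<^esub> \<one>\<^bsub>R\<^esub>) \<odot>\<^bsub>alg\<^esub> a \<in> carrier alg"
      using a by (intro alg_smult_closed) auto
    show "(\<ominus>\<^bsub>R\<^esub> \<one>\<^bsub>R\<^esub>) \<odot>\<^bsub>alg\<^esub> a \<oplus>\<^bsub>alg\<^esub> a = \<zero>\<^bsub>alg\<^esub>"
      using alg_closed[OF a] by (auto simp: alg_apply R.l_minus R.l_neg)
  qed
qed (auto simp: alg_apply alg_closed R.a_ac intro: alg_add_closed)

lemma alg_module: "module R alg"
  by (rule moduleI)
    (auto simp: alg_apply alg_closed R.l_distr R.r_distr R.m_assoc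
      intro: alg_abelian_group alg_smult_closed R.is_cring)

text \<open>A sum or scalar in the left factor is handled by linearity of the outer pairing in its
  element. In the right factor it is first taken out of the inner pairing and then out of the
  function of the outer one.\<close>

lemma alg_assoc_algebra: "assoc_algebra R alg"
proof -
  note closed = pairing_closed
  have "ring alg"
  proof (rule ringI)
    fix a b c assume a: "a \<in> carrier alg" and b: "b \<in> carrier alg" and c: "c \<in> carrier alg"
    show "(a \<oplus>\<^bsub>alg\<^esub> b) \<otimes>\<^bsub>alg\<^esub> c = a \<otimes>\<^bsub>alg\<^esub> c \<oplus>\<^bsub>alg\<^esub> b \<otimes>\<^bsub>alg\<^esub> c"
    proof (rule alg_eqI)
      fix \<phi> assume \<phi>: "\<phi> \<in> carrier M \<rightarrow> carrier R"
      then show "pairing \<phi> ((a \<oplus>\<^bsub>alg\<^esub> b) \<otimes>\<^bsub>alg\<^esub> c) = pairing \<phi> (a \<otimes>\<^bsub>alg\<^esub> c \<oplus>\<^bsub>alg\<^esub> b \<otimes>\<^bsub>alg\<^esub> c)"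
        using a b c closed
        by (simp add: lin_ext_mult[OF reg] lin_ext_add[OF reg] alg_add_closed alg_mult_closed Pi_def)
    qed (use a b c in \<open>auto intro: alg_mult_closed alg_add_closed\<close>)
    show "c \<otimes>\<^bsub>alg\<^esub> (a \<oplus>\<^bsub>alg\<^esub> b) = c \<otimes>\<^bsub>alg\<^esub> a \<oplus>\<^bsub>alg\<^esub> c \<otimes>\<^bsub>alg\<^esub> b"
    proof (rule alg_eqI)
      fix \<phi> assume \<phi>: "\<phi> \<in> carrier M \<rightarrow> carrier R"
      have "pairing \<phi> (c \<otimes>\<^bsub>alg\<^esub> (a \<oplus>\<^bsub>alg\<^esub> b)) =
          pairing (\<lambda>u. pairing (\<lambda>v. \<phi> (u \<otimes>\<^bsub>M\<^esub> v)) (a \<oplus>\<^bsub>alg\<^esub> b)) c"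
        using \<phi> a b c by (intro lin_ext_mult[OF reg]) (auto intro: alg_add_closed)
      also have "\<dots> = pairing (\<lambda>u. pairing (\<lambda>v. \<phi> (u \<otimes>\<^bsub>M\<^esub> v)) a \<oplus>\<^bsub>regular_module R\<^esub>
          pairing (\<lambda>v. \<phi> (u \<otimes>\<^bsub>M\<^esub> v)) b) c"
      proof (rule lin_ext_cong[OF reg c])
        fix u assume "u \<in> carrier M"
        then show "pairing (\<lambda>v. \<phi> (u \<otimes>\<^bsub>M\<^esub> v)) (a \<oplus>\<^bsub>alg\<^esub> b) = pairing (\<lambda>v. \<phi> (u \<otimes>\<^bsub>M\<^esub> v)) a
            \<oplus>\<^bsub>regular_module R\<^esub> pairing (\<lambda>v. \<phi> (u \<otimes>\<^bsub>M\<^esub> v)) b"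
          using \<phi> by (intro lin_ext_add[OF reg a b]) auto
      qed (use \<phi> a b in \<open>auto intro!: closed\<close>)
      also have "\<dots> = pairing \<phi> (c \<otimes>\<^bsub>alg\<^esub> a) \<oplus>\<^bsub>regular_module R\<^esub> pairing \<phi> (c \<otimes>\<^bsub>alg\<^esub> b)"
        using \<phi> a b c
        by (subst lin_ext_fun_add[OF reg]) (auto simp: lin_ext_mult[OF reg] intro!: closed)
      also have "\<dots> = pairing \<phi> (c \<otimes>\<^bsub>alg\<^esub> a \<oplus>\<^bsub>alg\<^esub> c \<otimes>\<^bsub>alg\<^esub> b)"
        using \<phi> a b c by (intro lin_ext_add[OF reg, symmetric]) (auto intro: alg_mult_closed)
      finally show "pairing \<phi> (c \<otimes>\<^bsub>alg\<^esub> (a \<oplus>\<^bsub>alg\<^esub> b)) =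
          pairing \<phi> (c \<otimes>\<^bsub>alg\<^esub> a \<oplus>\<^bsub>alg\<^esub> c \<otimes>\<^bsub>alg\<^esub> b)" .
    qed (use a b c in \<open>auto intro: alg_mult_closed alg_add_closed\<close>)
  qed (auto intro: alg_abelian_group alg_monoid)
  moreover have "(c \<odot>\<^bsub>alg\<^esub> x) \<otimes>\<^bsub>alg\<^esub> y = c \<odot>\<^bsub>alg\<^esub> (x \<otimes>\<^bsub>alg\<^esub> y)"
    if c: "c \<in> carrier R" and x: "x \<in> carrier alg" and y: "y \<in> carrier alg" for c x y
  proof (rule alg_eqI)
    fix \<phi> assume \<phi>: "\<phi> \<in> carrier M \<rightarrow> carrier R"
    then show "pairing \<phi> ((c \<odot>\<^bsub>alg\<^esub> x) \<otimes>\<^bsub>alg\<^esub> y) = pairing \<phi> (c \<odot>\<^bsub>alg\<^esub> (x \<otimes>\<^bsub>alg\<^esub> y))"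
      using c x y closed
      by (simp add: lin_ext_mult[OF reg] lin_ext_smult[OF reg] alg_smult_closed alg_mult_closed Pi_def)
  qed (use that in \<open>auto intro: alg_mult_closed alg_smult_closed\<close>)
  moreover have "x \<otimes>\<^bsub>alg\<^esub> (c \<odot>\<^bsub>alg\<^esub> y) = c \<odot>\<^bsub>alg\<^esub> (x \<otimes>\<^bsub>alg\<^esub> y)"
    if c: "c \<in> carrier R" and x: "x \<in> carrier alg" and y: "y \<in> carrier alg" for c x y
  proof (rule alg_eqI)
    fix \<phi> assume \<phi>: "\<phi> \<in> carrier M \<rightarrow> carrier R"
    have "pairing \<phi> (x \<otimes>\<^bsub>alg\<^esub> (c \<odot>\<^bsub>alg\<^esub> y)) =
        pairing (\<lambda>u. pairing (\<lambda>v. \<phi> (u \<otimes>\<^bsub>M\<^esub> v)) (c \<odot>\<^bsub>alg\<^esub> y)) x"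
      using \<phi> c x y by (intro lin_ext_mult[OF reg]) (auto intro: alg_smult_closed)
    also have "\<dots> = pairing (\<lambda>u. c \<odot>\<^bsub>regular_module R\<^esub> pairing (\<lambda>v. \<phi> (u \<otimes>\<^bsub>M\<^esub> v)) y) x"
    proof (rule lin_ext_cong[OF reg x])
      fix u assume "u \<in> carrier M"
      then show "pairing (\<lambda>v. \<phi> (u \<otimes>\<^bsub>M\<^esub> v)) (c \<odot>\<^bsub>alg\<^esub> y) =
          c \<odot>\<^bsub>regular_module R\<^esub> pairing (\<lambda>v. \<phi> (u \<otimes>\<^bsub>M\<^esub> v)) y"
        using \<phi> by (intro lin_ext_smult[OF reg c y]) auto
    qed (use \<phi> c y in \<open>auto intro!: closed\<close>)
    also have "\<dots> = c \<odot>\<^bsub>regular_module R\<^esub> pairing \<phi> (x \<otimes>\<^bsub>alg\<^esub> y)"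
      using \<phi> c x y
      by (subst lin_ext_fun_smult[OF reg]) (auto simp: lin_ext_mult[OF reg] intro!: closed)
    also have "\<dots> = pairing \<phi> (c \<odot>\<^bsub>alg\<^esub> (x \<otimes>\<^bsub>alg\<^esub> y))"
      using \<phi> c x y by (intro lin_ext_smult[OF reg, symmetric]) (auto intro: alg_mult_closed)
    finally show "pairing \<phi> (x \<otimes>\<^bsub>alg\<^esub> (c \<odot>\<^bsub>alg\<^esub> y)) = pairing \<phi> (c \<odot>\<^bsub>alg\<^esub> (x \<otimes>\<^bsub>alg\<^esub> y))" .
  qed (use that in \<open>auto intro: alg_mult_closed alg_smult_closed\<close>)
  ultimately show ?thesis
    by (intro assoc_algebra.intro assoc_algebra_axioms.intro alg_module)
qed

lemma basis_elem_mult: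
  assumes "u \<in> carrier M" and "v \<in> carrier M"
  shows "basis_elem R u \<otimes>\<^bsub>alg\<^esub> basis_elem R v = basis_elem R (u \<otimes>\<^bsub>M\<^esub> v)"
proof (rule alg_eqI)
  fix \<phi> assume \<phi>: "\<phi> \<in> carrier M \<rightarrow> carrier R"
  have "pairing \<phi> (basis_elem R u \<otimes>\<^bsub>alg\<^esub> basis_elem R v) =
      pairing (\<lambda>u. pairing (\<lambda>v. \<phi> (u \<otimes>\<^bsub>M\<^esub> v)) (basis_elem R v)) (basis_elem R u)"
    using \<phi> assms by (intro lin_ext_mult[OF reg]) (auto intro: basis_elem_closed)
  also have "\<dots> = pairing (\<lambda>v. \<phi> (u \<otimes>\<^bsub>M\<^esub> v)) (basis_elem R v)"
    using \<phi> assms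
    by (intro lin_ext_basis_elem[OF reg]) (auto intro!: pairing_closed basis_elem_closed)
  also have "\<dots> = \<phi> (u \<otimes>\<^bsub>M\<^esub> v)"
    using \<phi> assms by (intro lin_ext_basis_elem[OF reg]) auto
  also have "\<dots> = pairing \<phi> (basis_elem R (u \<otimes>\<^bsub>M\<^esub> v))"
    using \<phi> assms by (intro lin_ext_basis_elem[OF reg, symmetric]) auto
  finally show "pairing \<phi> (basis_elem R u \<otimes>\<^bsub>alg\<^esub> basis_elem R v) =
      pairing \<phi> (basis_elem R (u \<otimes>\<^bsub>M\<^esub> v))" .
qed (use assms in \<open>auto intro: basis_elem_closed alg_mult_closed\<close>)

section \<open>Universal property of the monoid algebra\<close>

lemma lin_ext_linear_map:
  assumes N: "module R N" and \<phi>: "\<phi> \<in> carrier M \<rightarrow> carrier N"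
  shows "lin_ext R N \<phi> \<in> linear_maps R alg N"
  using lin_ext_add[OF N _ _ \<phi>] lin_ext_smult[OF N _ _ \<phi>] lin_ext_closed[OF N _ \<phi>]
  by (auto simp: linear_maps_def)

text \<open>The pairing is a linear map, so it passes through the combination and is evaluated at
  basis elements only, where it returns the value of \<open>\<phi>\<close>.\<close>

lemma alg_expand:
  assumes a: "a \<in> carrier alg"
  shows "lin_ext R alg (basis_elem R) a = a"
proof (rule alg_eqI)
  have basis: "basis_elem R \<in> carrier M \<rightarrow> carrier alg"
    by (auto intro: basis_elem_closed)
  show "lin_ext R alg (basis_elem R) a \<in> carrier alg"
    by (rule lin_ext_closed[OF alg_module a basis])
  fix \<phi> assume \<phi>: "\<phi> \<in> carrier M \<rightarrow> carrier R"
  have "pairing \<phi> (lin_ext R alg (basis_elem R) a) = pairing (pairing \<phi> \<circ> basis_elem R) a"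
    using \<phi> alg_closed[OF a] basis
    by (intro linear_map_lin_ext[OF alg_module reg lin_ext_linear_map[OF reg]]) (auto simp: supp_def)
  also have "\<dots> = pairing \<phi> a"
    using \<phi> lin_ext_basis_elem[OF reg, of _ \<phi>] by (intro lin_ext_cong[OF reg a]) auto
  finally show "pairing \<phi> (lin_ext R alg (basis_elem R) a) = pairing \<phi> a" .
qed (rule a)

text \<open>Linear maps out of the algebra are determined by their values on the basis; the
  uniqueness of \<open>rho\<close> rests on this.\<close>

lemma linear_map_alg_expand:
  assumes N: "module R N" and f: "f \<in> linear_maps R alg N" and a: "a \<in> carrier alg"
  shows "f a = lin_ext R N (\<lambda>m. f (basis_elem R m)) a"
proof -
  have "f (lin_ext R alg (basis_elem R) a) = lin_ext R N (f \<circ> basis_elem R) a"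
    using alg_closed[OF a]
    by (intro linear_map_lin_ext[OF alg_module N f]) (auto simp: supp_def intro: basis_elem_closed)
  then show ?thesis
    by (simp add: alg_expand[OF a] o_def)
qed

text \<open>Left and right multiplication by a fixed element of \<open>H\<close> are linear. Pulling
  them out of the two nested extensions of \<open>lin_ext_mult\<close> factors the double sum into a
  product.\<close>

lemma lin_ext_alg_hom:
  assumes H: "assoc_algebra R H" and f: "f \<in> hom M H" and one: "f \<one>\<^bsub>M\<^esub> = \<one>\<^bsub>H\<^esub>"
  shows "lin_ext R H f \<in> alg_hom R alg H"
proof -
  interpret H: assoc_algebra R H by fact
  have f_closed: "f \<in> carrier M \<rightarrow> carrier H"
    using f by (auto simp: hom_def)
  note N = H.module_axioms
  have "lin_ext R H f (a \<otimes>\<^bsub>alg\<^esub> b) = lin_ext R H f a \<otimes>\<^bsub>H\<^esub> lin_ext R H f b"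
    if a: "a \<in> carrier alg" and b: "b \<in> carrier alg" for a b
  proof -
    let ?b = "lin_ext R H f b"
    have b': "?b \<in> carrier H"
      by (rule lin_ext_closed[OF N b f_closed])
    have left: "(\<lambda>y. x \<otimes>\<^bsub>H\<^esub> y) \<in> linear_maps R H H" if "x \<in> carrier H" for x
      using that by (auto simp: linear_maps_def H.r_distr H.smult_mult_r)
    have right: "(\<lambda>x. x \<otimes>\<^bsub>H\<^esub> ?b) \<in> linear_maps R H H"
      using b' by (auto simp: linear_maps_def H.l_distr H.smult_mult_l)
    have "lin_ext R H f (a \<otimes>\<^bsub>alg\<^esub> b) = lin_ext R H (\<lambda>u. lin_ext R H (\<lambda>v. f (u \<otimes>\<^bsub>M\<^esub> v)) b) a"
      by (rule lin_ext_mult[OF N a b f_closed])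
    also have "\<dots> = lin_ext R H ((\<lambda>x. x \<otimes>\<^bsub>H\<^esub> ?b) \<circ> f) a"
    proof (rule lin_ext_cong[OF N a])
      fix u assume u: "u \<in> carrier M"
      then have fu: "f u \<in> carrier H"
        using f_closed by auto
      have "lin_ext R H (\<lambda>v. f (u \<otimes>\<^bsub>M\<^esub> v)) b = lin_ext R H ((\<lambda>y. f u \<otimes>\<^bsub>H\<^esub> y) \<circ> f) b"
        using u fu f_closed hom_mult[OF f u] by (intro lin_ext_cong[OF N b]) (auto simp: Pi_def)
      also have "\<dots> = f u \<otimes>\<^bsub>H\<^esub> ?b"
        using f_closed alg_closed[OF b]
        by (intro linear_map_lin_ext[OF N N left[OF fu], symmetric]) (auto simp: supp_def)
      finally show "lin_ext R H (\<lambda>v. f (u \<otimes>\<^bsub>M\<^esub> v)) b = ((\<lambda>x. x \<otimes>\<^bsub>H\<^esub> ?b) \<circ> f) u"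
        by simp
    qed (use b' f_closed in \<open>auto simp: Pi_def\<close>)
    also have "\<dots> = lin_ext R H f a \<otimes>\<^bsub>H\<^esub> ?b"
      using f_closed alg_closed[OF a]
      by (intro linear_map_lin_ext[OF N N right, symmetric]) (auto simp: supp_def)
    finally show ?thesis .
  qed
  moreover have "lin_ext R H f \<one>\<^bsub>alg\<^esub> = \<one>\<^bsub>H\<^esub>"
    unfolding one_alg using one by (simp add: lin_ext_basis_elem[OF N _ f_closed])
  ultimately show ?thesis
    unfolding alg_hom_def
    using lin_ext_add[OF N _ _ f_closed] lin_ext_smult[OF N _ _ f_closed] lin_ext_closed[OF N _ f_closed]
    by (auto intro!: ring_hom_memI)
qed

end


subsection \<open>Quotient algebras\<close>

lemma quotient_algebra_simps:
  "carrier (quotient_algebra A I) = a_rcosets\<^bsub>A\<^esub> I"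
  "mult (quotient_algebra A I) = rcoset_mult A I"
  "\<one>\<^bsub>quotient_algebra A I\<^esub> = I +>\<^bsub>A\<^esub> \<one>\<^bsub>A\<^esub>"
  "\<zero>\<^bsub>quotient_algebra A I\<^esub> = I"
  "add (quotient_algebra A I) = set_add A"
  "smult (quotient_algebra A I) = (\<lambda>c U. \<Union>a\<in>U. I +>\<^bsub>A\<^esub> (c \<odot>\<^bsub>A\<^esub> a))"
  by (simp_all add: quotient_algebra_def FactRing_def ring.defs module.defs)

locale quotient_algebra_setup = assoc_algebra R A + I: ideal I A
  for R (structure) and A :: "('r, 'a) module" and I
begin

abbreviation Q :: "('r, 'a set) module" where
  "Q \<equiv> quotient_algebra A I"

abbreviation proj :: "'a \<Rightarrow> 'a set" where
  "proj a \<equiv> I +>\<^bsub>A\<^esub> a"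

lemma quotient_cases:
  assumes "U \<in> carrier Q"
  obtains a where "a \<in> carrier A" and "U = proj a"
  using assms by (auto simp: quotient_algebra_simps A_RCOSETS_def')

lemma proj_closed: "a \<in> carrier A \<Longrightarrow> proj a \<in> carrier Q"
  by (auto simp: quotient_algebra_simps A_RCOSETS_def')

lemma proj_mult:
  "\<lbrakk>a \<in> carrier A; b \<in> carrier A\<rbrakk> \<Longrightarrow> proj a \<otimes>\<^bsub>Q\<^esub> proj b = proj (a \<otimes>\<^bsub>A\<^esub> b)"
  by (simp add: quotient_algebra_simps I.rcoset_mult_add)

lemma proj_add:
  "\<lbrakk>a \<in> carrier A; b \<in> carrier A\<rbrakk> \<Longrightarrow> proj a \<oplus>\<^bsub>Q\<^esub> proj b = proj (a \<oplus>\<^bsub>A\<^esub> b)"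
  by (simp add: quotient_algebra_simps I.a_rcos_sum)

text \<open>An ideal is closed under ring multiplication only by definition; a scalar
  \<open>c\<close> acts as multiplication by \<open>c \<odot> \<one>\<close>.\<close>

lemma ideal_smult_closed:
  assumes "c \<in> carrier R" and "i \<in> I"
  shows "c \<odot>\<^bsub>A\<^esub> i \<in> I"
proof -
  have "(c \<odot>\<^bsub>A\<^esub> \<one>\<^bsub>A\<^esub>) \<otimes>\<^bsub>A\<^esub> i \<in> I"
    using assms by (intro I.I_l_closed) auto
  then show ?thesis
    using assms I.a_Hcarr by (simp add: smult_mult_l)
qed

text \<open>A scalar multiple of a coset is a union over its elements. These differ by elements of
  \<open>I\<close>, which scalars keep in \<open>I\<close>, so each of them gives the same
  coset.\<close>

lemma proj_smult:
  assumes c: "c \<in> carrier R" and a: "a \<in> carrier A"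
  shows "c \<odot>\<^bsub>Q\<^esub> proj a = proj (c \<odot>\<^bsub>A\<^esub> a)"
proof -
  have "proj (c \<odot>\<^bsub>A\<^esub> a') = proj (c \<odot>\<^bsub>A\<^esub> a)" if a': "a' \<in> proj a" for a'
  proof -
    obtain i where i: "i \<in> I" "a' = i \<oplus>\<^bsub>A\<^esub> a"
      using a' by (auto simp: a_r_coset_def')
    then have "c \<odot>\<^bsub>A\<^esub> a' = c \<odot>\<^bsub>A\<^esub> i \<oplus>\<^bsub>A\<^esub> c \<odot>\<^bsub>A\<^esub> a"
      using c a I.a_Hcarr by (simp add: smult_r_distr)
    then have "c \<odot>\<^bsub>A\<^esub> a' \<in> proj (c \<odot>\<^bsub>A\<^esub> a)"
      using ideal_smult_closed[OF c i(1)] by (auto simp: a_r_coset_def')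
    then show ?thesis
      using I.a_repr_independence'[of "c \<odot>\<^bsub>A\<^esub> a'" "c \<odot>\<^bsub>A\<^esub> a"] c a by simp
  qed
  moreover have "a \<in> proj a"
    using a by (rule I.a_rcos_self)
  ultimately show ?thesis
    unfolding quotient_algebra_simps by blast
qed

text \<open>\<open>Q\<close> agrees with \<open>A Quot I\<close> in all ring fields but is a
  different record, so the laws are carried over field by field.\<close>

lemma quotient_ring: "ring Q"
proof -
  interpret F: ring "A Quot I" by (rule I.quotient_is_ring)
  have F: "carrier Q = carrier (A Quot I)" "mult Q = mult (A Quot I)" "one Q = one (A Quot I)"
    "zero Q = zero (A Quot I)" "add Q = add (A Quot I)"
    by (simp_all add: quotient_algebra_simps FactRing_def)
  have "\<exists>V\<in>carrier (A Quot I). V \<oplus>\<^bsub>A Quot I\<^esub> U = \<zero>\<^bsub>A Quot I\<^esub>" if "U \<in> carrier (A Quot I)" for U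
    using that F.l_neg by blast
  then have "abelian_group Q"
    by (intro abelian_groupI) (simp_all add: F F.a_ac)
  then show ?thesis
    by (intro ringI monoidI) (simp_all add: F F.m_assoc F.l_distr F.r_distr)
qed

lemma quotient_assoc_algebra: "assoc_algebra R Q"
proof -
  interpret Q: ring Q by (rule quotient_ring)
  have "module R Q"
    by (rule moduleI; (elim quotient_cases)?)
      (simp_all add: R.is_cring Q.is_abelian_group proj_smult proj_add proj_closed
        smult_l_distr smult_r_distr smult_assoc1)
  then show ?thesis
    by (intro assoc_algebra.intro assoc_algebra_axioms.intro quotient_ring; (elim quotient_cases)?)
      (simp_all add: proj_smult proj_mult smult_mult_l smult_mult_r)
qed

lemma proj_alg_hom: "proj \<in> alg_hom R A Q"
  unfolding alg_hom_def
  by (auto simp: proj_mult proj_add proj_smult proj_closed quotient_algebra_simps(3)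
      intro!: ring_hom_memI)

end

lemma alg_hom_props:
  assumes "f \<in> alg_hom R A H"
  shows "a \<in> carrier A \<Longrightarrow> f a \<in> carrier H"
    and "\<lbrakk>a \<in> carrier A; b \<in> carrier A\<rbrakk> \<Longrightarrow> f (a \<otimes>\<^bsub>A\<^esub> b) = f a \<otimes>\<^bsub>H\<^esub> f b"
    and "\<lbrakk>a \<in> carrier A; b \<in> carrier A\<rbrakk> \<Longrightarrow> f (a \<oplus>\<^bsub>A\<^esub> b) = f a \<oplus>\<^bsub>H\<^esub> f b"
    and "f \<one>\<^bsub>A\<^esub> = \<one>\<^bsub>H\<^esub>"
    and "\<lbrakk>c \<in> carrier R; a \<in> carrier A\<rbrakk> \<Longrightarrow> f (c \<odot>\<^bsub>A\<^esub> a) = c \<odot>\<^bsub>H\<^esub> f a"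
  using assms by (auto simp: alg_hom_def ring_hom_def)

text \<open>The kernel of \<open>f\<close> is an ideal containing \<open>S\<close>, hence contains
  the ideal generated by \<open>S\<close>; so \<open>f\<close> is constant on cosets.\<close>

lemma (in assoc_algebra) genideal_quotient_alg_hom_exists:
  assumes H: "assoc_algebra R H" and f: "f \<in> alg_hom R A H"
    and S: "S \<subseteq> carrier A" and zero: "\<And>s. s \<in> S \<Longrightarrow> f s = \<zero>\<^bsub>H\<^esub>"
  obtains f' where "f' \<in> alg_hom R (quotient_algebra A (Idl\<^bsub>A\<^esub> S)) H"
    and "\<And>a. a \<in> carrier A \<Longrightarrow> f' (Idl\<^bsub>A\<^esub> S +>\<^bsub>A\<^esub> a) = f a"
proof
  have "ring H"
    using H by (simp add: assoc_algebra_def)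
  then have "ring_hom_ring A H f"
    using f by (intro ring_hom_ringI2) (simp_all add: alg_hom_def ring_axioms)
  then have kernel: "ideal (a_kernel A H f) A"
    by (rule ring_hom_ring.kernel_is_ideal)
  define I where "I = Idl\<^bsub>A\<^esub> S"
  interpret quotient_algebra_setup R A I
    unfolding I_def by (rule quotient_algebra_setup.intro[OF assoc_algebra_axioms genideal_ideal[OF S]])
  have "I \<subseteq> a_kernel A H f"
    unfolding I_def using S zero
    by (intro genideal_minimal kernel) (auto simp: a_kernel_def')
  then have I: "f i = \<zero>\<^bsub>H\<^esub>" if "i \<in> I" for i
    using that by (auto simp: a_kernel_def')
  \<comment> \<open>A chosen representative differs from any other one by an element of
    \<open>I\<close>, which \<open>f\<close> kills.\<close>
  define f' where "f' U = f (SOME a. a \<in> U)" for U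
  have f': "f' (proj a) = f a" if a: "a \<in> carrier A" for a
  proof -
    have "(SOME b. b \<in> proj a) \<in> proj a"
      using I.a_rcos_self[OF a] by (rule someI)
    then obtain i where "i \<in> I" "(SOME b. b \<in> proj a) = i \<oplus>\<^bsub>A\<^esub> a"
      by (auto simp: a_r_coset_def')
    then show ?thesis
      using a I.a_Hcarr f \<open>ring H\<close>
      by (simp add: f'_def I alg_hom_props[OF f] ring.ring_simprules)
  qed
  then show "\<And>a. a \<in> carrier A \<Longrightarrow> f' (Idl\<^bsub>A\<^esub> S +>\<^bsub>A\<^esub> a) = f a"
    by (simp add: I_def)
  have "f' \<in> alg_hom R Q H"
    unfolding alg_hom_def
  proof (intro CollectI conjI ballI ring_hom_memI; (elim quotient_cases)?)
    show "f' \<one>\<^bsub>Q\<^esub> = \<one>\<^bsub>H\<^esub>"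
      using f by (simp add: quotient_algebra_simps f' alg_hom_props)
  qed (use f in \<open>simp_all add: f' proj_mult proj_add proj_smult alg_hom_props\<close>)
  then show "f' \<in> alg_hom R (quotient_algebra A (Idl\<^bsub>A\<^esub> S)) H"
    by (simp add: I_def)
qed


subsection \<open>Hecke quotients of monoid algebras\<close>

lemma assoc_algebra_ring: "assoc_algebra R A \<Longrightarrow> ring A"
  by (simp add: assoc_algebra_def)

lemma assoc_algebra_monoid: "assoc_algebra R A \<Longrightarrow> Group.monoid A"
  by (simp add: assoc_algebra_def ring_def)

lemma alg_hom_minus:
  assumes A: "assoc_algebra R A" and H: "assoc_algebra R H" and f: "f \<in> alg_hom R A H"
    and "a \<in> carrier A" and "b \<in> carrier A"
  shows "f (a \<ominus>\<^bsub>A\<^esub> b) = f a \<ominus>\<^bsub>H\<^esub> f b"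
proof -
  interpret A: ring A by (rule assoc_algebra_ring[OF A])
  have "ring_hom_ring A H f"
    using f by (intro ring_hom_ringI2 assoc_algebra_ring[OF A] assoc_algebra_ring[OF H])
      (simp add: alg_hom_def)
  then interpret ring_hom_ring A H f .
  show ?thesis
    using assms(4,5) by (simp add: a_minus_def)
qed

text \<open>Both \<^const>\<open>hecke\<close> and \<^const>\<open>pseudo_hecke\<close> are instances of the following quotient.\<close>

locale hecke_quotient = cring R for R (structure) +
  fixes q :: 'a and n :: nat and S :: "letter set" and Rel :: "(letter list \<times> letter list) set"
  assumes q_closed: "q \<in> carrier R" and Sig_letter: "i \<in> {1..<n} \<Longrightarrow> Sig i \<in> S"
begin

abbreviation M :: "letter list set monoid" where
  "M \<equiv> presented_monoid S Rel"

abbreviation malg :: "('a, letter list set \<Rightarrow> 'a) module" where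
  "malg \<equiv> monoid_algebra R M"

definition relators :: "(letter list set \<Rightarrow> 'a) set" where
  "relators = hecke_relators R q n malg (\<lambda>i. basis_elem R (word_class S Rel [Sig i]))"

definition K :: "('a, (letter list set \<Rightarrow> 'a) set) module" where
  "K = quotient_algebra malg (Idl\<^bsub>malg\<^esub> relators)"

definition pr :: "letter list set \<Rightarrow> (letter list set \<Rightarrow> 'a) set" where
  "pr m = Idl\<^bsub>malg\<^esub> relators +>\<^bsub>malg\<^esub> basis_elem R m"

text \<open>Kept in the shape of \<open>hecke_relators\<close>, so that the image of a relator under
  an algebra homomorphism is literally the left-hand side.\<close>

definition quadratic :: "('a, 'h) module \<Rightarrow> 'h \<Rightarrow> bool" where
  "quadratic H x \<longleftrightarrow> x \<otimes>\<^bsub>H\<^esub> x \<ominus>\<^bsub>H\<^esub> (q \<ominus> \<one>) \<odot>\<^bsub>H\<^esub> x \<ominus>\<^bsub>H\<^esub> q \<odot>\<^bsub>H\<^esub> \<one>\<^bsub>H\<^esub> = \<zero>\<^bsub>H\<^esub>"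

lemma alg_setup: "monoid_algebra_setup R M"
  by (intro monoid_algebra_setup.intro is_cring monoid_presented_monoid)

lemma malg_assoc_algebra: "assoc_algebra R malg"
  by (rule monoid_algebra_setup.alg_assoc_algebra[OF alg_setup])

lemma basis_closed: "m \<in> carrier M \<Longrightarrow> basis_elem R m \<in> carrier malg"
  by (rule monoid_algebra_setup.basis_elem_closed[OF alg_setup])

lemma alg_hom_relator:
  assumes A: "assoc_algebra R A" and H: "assoc_algebra R H" and f: "f \<in> alg_hom R A H"
    and x: "x \<in> carrier A"
  shows "f (x \<otimes>\<^bsub>A\<^esub> x \<ominus>\<^bsub>A\<^esub> (q \<ominus> \<one>) \<odot>\<^bsub>A\<^esub> x \<ominus>\<^bsub>A\<^esub> q \<odot>\<^bsub>A\<^esub> \<one>\<^bsub>A\<^esub>) =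
    f x \<otimes>\<^bsub>H\<^esub> f x \<ominus>\<^bsub>H\<^esub> (q \<ominus> \<one>) \<odot>\<^bsub>H\<^esub> f x \<ominus>\<^bsub>H\<^esub> q \<odot>\<^bsub>H\<^esub> \<one>\<^bsub>H\<^esub>"
proof -
  interpret A: ring A by (rule assoc_algebra_ring[OF A])
  have smult: "c \<odot>\<^bsub>A\<^esub> y \<in> carrier A" if "c \<in> carrier R" "y \<in> carrier A" for c y
    using module.smult_closed[of R A c y] A that by (simp add: assoc_algebra_def)
  show ?thesis
    using x q_closed by (simp add: alg_hom_minus[OF A H f] alg_hom_props[OF f] smult)
qed

lemma relators_subset: "relators \<subseteq> carrier malg"
proof -
  interpret A: assoc_algebra R malg by (rule malg_assoc_algebra)
  have "basis_elem R (word_class S Rel [Sig i]) \<in> carrier malg" if "i \<in> {1..<n}" for i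
    using Sig_letter[OF that] by (intro basis_closed word_class_closed) simp
  then show ?thesis
    using q_closed unfolding relators_def hecke_relators_def by auto
qed

lemma quotient_setup: "quotient_algebra_setup R malg (Idl\<^bsub>malg\<^esub> relators)"
  by (intro quotient_algebra_setup.intro malg_assoc_algebra
      ring.genideal_ideal[OF assoc_algebra_ring[OF malg_assoc_algebra] relators_subset])

lemma K_assoc_algebra: "assoc_algebra R K"
  unfolding K_def by (rule quotient_algebra_setup.quotient_assoc_algebra[OF quotient_setup])

lemma malg_K_hom: "(\<lambda>a. Idl\<^bsub>malg\<^esub> relators +>\<^bsub>malg\<^esub> a) \<in> alg_hom R malg K"
  unfolding K_def by (rule quotient_algebra_setup.proj_alg_hom[OF quotient_setup])

lemma pr_hom: "pr \<in> hom M K"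
  using monoid_algebra_setup.basis_elem_mult[OF alg_setup]
  by (intro homI)
    (simp_all add: pr_def basis_closed alg_hom_props(1)[OF malg_K_hom]
      flip: alg_hom_props(2)[OF malg_K_hom])

lemma pr_one: "pr \<one>\<^bsub>M\<^esub> = \<one>\<^bsub>K\<^esub>"
  using alg_hom_props(4)[OF malg_K_hom] monoid_algebra_setup.one_alg[OF alg_setup]
  by (simp add: pr_def)

lemma pr_word_closed: "w \<in> lists S \<Longrightarrow> pr (word_class S Rel w) \<in> carrier K"
  using pr_hom by (auto simp: hom_def intro: word_class_closed)

lemma pr_append:
  assumes "u \<in> lists S" and "v \<in> lists S"
  shows "pr (word_class S Rel (u @ v)) = pr (word_class S Rel u) \<otimes>\<^bsub>K\<^esub> pr (word_class S Rel v)"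
  using hom_mult[OF pr_hom, of "word_class S Rel u" "word_class S Rel v"] assms
  by (simp add: word_class_mult word_class_closed)

lemma pr_Nil: "pr (word_class S Rel []) = \<one>\<^bsub>K\<^esub>"
  using pr_one by (simp add: one_presented_monoid)

lemma pr_word: "w \<in> lists S \<Longrightarrow> pr (word_class S Rel w) = word_val K (\<lambda>l. pr (word_class S Rel [l])) w"
proof -
  assume w: "w \<in> lists S"
  have "pr (word_val M (\<lambda>l. word_class S Rel [l]) w) =
      word_val K (pr \<circ> (\<lambda>l. word_class S Rel [l])) w"
    using w by (intro word_val_hom[OF monoid_presented_monoid assoc_algebra_monoid[OF K_assoc_algebra]
          _ pr_hom pr_one]) (auto intro: word_class_closed)
  then show ?thesis
    using w by (simp add: word_val_word_class o_def)
qed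

lemma pr_rel:
  assumes "(u, v) \<in> Rel" and "u \<in> lists S" and "v \<in> lists S"
  shows "pr (word_class S Rel u) = pr (word_class S Rel v)"
  using assms pres_eq.rel[of u v Rel S] word_class_eq_iff[of u S Rel v] by simp

lemma quadratic_pr:
  assumes i: "i \<in> {1..<n}"
  shows "quadratic K (pr (word_class S Rel [Sig i]))"
proof -
  let ?I = "Idl\<^bsub>malg\<^esub> relators" and ?x = "basis_elem R (word_class S Rel [Sig i])"
  interpret quotient_algebra_setup R malg ?I by (rule quotient_setup)
  have x: "?x \<in> carrier malg"
    using Sig_letter[OF i] by (intro basis_closed word_class_closed) simp
  let ?r = "?x \<otimes>\<^bsub>malg\<^esub> ?x \<ominus>\<^bsub>malg\<^esub> (q \<ominus> \<one>) \<odot>\<^bsub>malg\<^esub> ?x \<ominus>\<^bsub>malg\<^esub> q \<odot>\<^bsub>malg\<^esub> \<one>\<^bsub>malg\<^esub>"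
  have "?r \<in> relators"
    unfolding relators_def hecke_relators_def using i by blast
  then have "?r \<in> ?I"
    using genideal_self[OF relators_subset] by blast
  then have "?I +>\<^bsub>malg\<^esub> ?r = \<zero>\<^bsub>K\<^esub>"
    by (simp add: I.a_rcos_const K_def quotient_algebra_simps)
  then show ?thesis
    unfolding quadratic_def pr_def
    using alg_hom_relator[OF malg_assoc_algebra K_assoc_algebra malg_K_hom x] by simp
qed

text \<open>Each condition serves one stage: \<open>rels\<close> lets the evaluation of words
  descend to \<open>M\<close>, and \<open>quad\<close> makes its linear extension vanish on the
  relators, so that it descends to \<open>K\<close>.\<close>

lemma alg_hom_exists:
  assumes H: "assoc_algebra R H" and \<phi>: "\<phi> \<in> S \<rightarrow> carrier H"
    and rels: "\<And>u v. (u, v) \<in> Rel \<Longrightarrow> u \<in> lists S \<Longrightarrow> v \<in> lists S \<Longrightarrow>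
      word_val H \<phi> u = word_val H \<phi> v"
    and quad: "\<And>i. i \<in> {1..<n} \<Longrightarrow> quadratic H (\<phi> (Sig i))"
  obtains f where "f \<in> alg_hom R K H"
    and "\<And>w. w \<in> lists S \<Longrightarrow> f (pr (word_class S Rel w)) = word_val H \<phi> w"
proof -
  have Hm: "Group.monoid H" and Hmod: "module R H"
    using H by (auto simp: assoc_algebra_monoid assoc_algebra_def)
  obtain h where h: "h \<in> hom M H" "h \<one>\<^bsub>M\<^esub> = \<one>\<^bsub>H\<^esub>"
      and hw: "\<And>w. w \<in> lists S \<Longrightarrow> h (word_class S Rel w) = word_val H \<phi> w"
  proof (rule presented_monoid_hom_exists[OF Hm \<phi>, of Rel])
    show "word_val H \<phi> u = word_val H \<phi> v" if "(u, v) \<in> Rel" "u \<in> lists S" "v \<in> lists S" for u v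
      by (rule rels[OF that])
  qed (rule that)
  define F where "F = lin_ext R H h"
  have F: "F \<in> alg_hom R malg H"
    unfolding F_def by (rule monoid_algebra_setup.lin_ext_alg_hom[OF alg_setup H h])
  have F_basis: "F (basis_elem R m) = h m" if "m \<in> carrier M" for m
    unfolding F_def using h that
    by (intro monoid_algebra_setup.lin_ext_basis_elem[OF alg_setup Hmod]) (auto simp: hom_def)
  have F_zero: "F s = \<zero>\<^bsub>H\<^esub>" if s: "s \<in> relators" for s
  proof -
    obtain i where i: "i \<in> {1..<n}"
      and s: "s = basis_elem R (word_class S Rel [Sig i]) \<otimes>\<^bsub>malg\<^esub> basis_elem R (word_class S Rel [Sig i])
        \<ominus>\<^bsub>malg\<^esub> (q \<ominus> \<one>) \<odot>\<^bsub>malg\<^esub> basis_elem R (word_class S Rel [Sig i]) \<ominus>\<^bsub>malg\<^esub> q \<odot>\<^bsub>malg\<^esub> \<one>\<^bsub>malg\<^esub>"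
      using s unfolding relators_def hecke_relators_def by blast
    have c: "word_class S Rel [Sig i] \<in> carrier M"
      using Sig_letter[OF i] by (intro word_class_closed) simp
    have "F (basis_elem R (word_class S Rel [Sig i])) = \<phi> (Sig i)"
      using Sig_letter[OF i] funcset_mem[OF \<phi> Sig_letter[OF i]] Hm by (simp add: F_basis[OF c] hw)
    then show ?thesis
      unfolding s using quad[OF i] alg_hom_relator[OF malg_assoc_algebra H F basis_closed[OF c]]
      by (simp add: quadratic_def)
  qed
  obtain f where f: "f \<in> alg_hom R K H"
      "\<And>a. a \<in> carrier malg \<Longrightarrow> f (Idl\<^bsub>malg\<^esub> relators +>\<^bsub>malg\<^esub> a) = F a"
  proof (rule assoc_algebra.genideal_quotient_alg_hom_exists[OF malg_assoc_algebra H F relators_subset,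
        folded K_def])
    show "F s = \<zero>\<^bsub>H\<^esub>" if "s \<in> relators" for s
      by (rule F_zero[OF that])
  qed (rule that)
  show ?thesis
  proof (rule that[OF f(1)])
    fix w assume "w \<in> lists S"
    then show "f (pr (word_class S Rel w)) = word_val H \<phi> w"
      by (simp add: pr_def f(2) basis_closed word_class_closed F_basis hw)
  qed
qed

text \<open>The letters generate \<open>K\<close> as an algebra: agreement spreads to words by
  multiplicativity, and from words to every coset by expanding a representative in the
  basis.\<close>

lemma alg_hom_eqI:
  assumes H: "assoc_algebra R H" and f: "f \<in> alg_hom R K H" and g: "g \<in> alg_hom R K H"
    and eq: "\<And>l. l \<in> S \<Longrightarrow> f (pr (word_class S Rel [l])) = g (pr (word_class S Rel [l]))"
    and U: "U \<in> carrier K"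
  shows "f U = g U"
proof -
  let ?p = "\<lambda>a. Idl\<^bsub>malg\<^esub> relators +>\<^bsub>malg\<^esub> a"
  have Hmod: "module R H" and Hm: "Group.monoid H" and Km: "Group.monoid K"
    using H K_assoc_algebra by (auto simp: assoc_algebra_monoid assoc_algebra_def)
  have word: "f (pr (word_class S Rel w)) = g (pr (word_class S Rel w))" if "w \<in> lists S" for w
    using that
  proof induction
    case Nil
    then show ?case
      using f g by (simp add: pr_Nil alg_hom_props)
  next
    case (Cons l w)
    then have "f (pr (word_class S Rel ([l] @ w))) = g (pr (word_class S Rel ([l] @ w)))"
      by (subst (1 2) pr_append)
        (simp_all add: alg_hom_props(2)[OF f] alg_hom_props(2)[OF g] pr_word_closed eq)
    then show ?case by simp
  qed
  have lin: "h \<circ> ?p \<in> linear_maps R malg H" if "h \<in> alg_hom R K H" for h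
    using alg_hom_props[OF that] alg_hom_props[OF malg_K_hom] by (auto simp: linear_maps_def)
  obtain a where a: "a \<in> carrier malg" and U_eq: "U = ?p a"
    using U unfolding K_def
    by (rule quotient_algebra_setup.quotient_cases[OF quotient_setup])
  have "f U = lin_ext R H (\<lambda>m. (f \<circ> ?p) (basis_elem R m)) a"
    using monoid_algebra_setup.linear_map_alg_expand[OF alg_setup Hmod lin[OF f] a] by (simp add: U_eq)
  also have "\<dots> = lin_ext R H (\<lambda>m. (g \<circ> ?p) (basis_elem R m)) a"
  proof (rule monoid_algebra_setup.lin_ext_cong[OF alg_setup Hmod a])
    show "(\<lambda>m. (g \<circ> ?p) (basis_elem R m)) \<in> carrier M \<rightarrow> carrier H"
      using alg_hom_props(1)[OF g] alg_hom_props(1)[OF malg_K_hom] by (auto intro: basis_closed)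
    fix m assume "m \<in> carrier M"
    then obtain w where "w \<in> lists S" "m = word_class S Rel w"
      by (rule presented_monoid_cases)
    then show "(f \<circ> ?p) (basis_elem R m) = (g \<circ> ?p) (basis_elem R m)"
      using word by (simp add: pr_def)
  qed
  also have "\<dots> = g U"
    using monoid_algebra_setup.linear_map_alg_expand[OF alg_setup Hmod lin[OF g] a] by (simp add: U_eq)
  finally show ?thesis .
qed

end


subsection \<open>The homomorphism \<open>\<rho>\<close>\<close>

text \<open>Multiply \<open>z \<otimes> x = y \<otimes> z\<close> by \<open>y'\<close> on the left
  and by \<open>x'\<close> on the right. No inverse of \<open>z\<close> enters, since
  \<open>z\<close> will also be the image of a pseudo generator, for which none is
  available.\<close>

lemma (in Group.monoid) intertwine_inverse:
  assumes z: "z \<in> carrier G" and x: "x \<in> carrier G" "x' \<in> carrier G" "x \<otimes> x' = \<one>"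
    and y: "y \<in> carrier G" "y' \<in> carrier G" "y' \<otimes> y = \<one>" and zx: "z \<otimes> x = y \<otimes> z"
  shows "z \<otimes> x' = y' \<otimes> z"
proof -
  have "z \<otimes> x' = y' \<otimes> (y \<otimes> z) \<otimes> x'"
    using z x y by (simp flip: m_assoc)
  also have "\<dots> = y' \<otimes> z \<otimes> (x \<otimes> x')"
    using z x y by (simp add: m_assoc flip: zx)
  finally show ?thesis
    using z x y by simp
qed

lemma (in assoc_algebra) intertwine_lincomb:
  assumes "z \<in> carrier A" "x \<in> carrier A" "x' \<in> carrier A" "y \<in> carrier A" "y' \<in> carrier A"
    and "X \<in> carrier R" "Y \<in> carrier R"
    and "z \<otimes>\<^bsub>A\<^esub> x = y \<otimes>\<^bsub>A\<^esub> z" and "z \<otimes>\<^bsub>A\<^esub> x' = y' \<otimes>\<^bsub>A\<^esub> z"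
  shows "z \<otimes>\<^bsub>A\<^esub> (X \<odot>\<^bsub>A\<^esub> x \<oplus>\<^bsub>A\<^esub> Y \<odot>\<^bsub>A\<^esub> x') = (X \<odot>\<^bsub>A\<^esub> y \<oplus>\<^bsub>A\<^esub> Y \<odot>\<^bsub>A\<^esub> y') \<otimes>\<^bsub>A\<^esub> z"
  using assms by (simp add: A.r_distr A.l_distr smult_mult_l smult_mult_r)

locale rho_setup = cring R for R (structure) +
  fixes q X Y :: 'a and n :: nat
  assumes q_closed: "q \<in> carrier R" and X_closed: "X \<in> carrier R" and Y_closed: "Y \<in> carrier R"
begin

abbreviation H :: "('a, (letter list set \<Rightarrow> 'a) set) module" where
  "H \<equiv> hecke R q n"

abbreviation PH :: "('a, (letter list set \<Rightarrow> 'a) set) module" where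
  "PH \<equiv> pseudo_hecke R q n"

interpretation C: hecke_quotient R q n "braid_letters n" "braid_rels n"
  by unfold_locales (use q_closed in \<open>auto simp: braid_letters_def\<close>)

interpretation P: hecke_quotient R q n "pseudo_letters n" "braid_rels n \<union> pseudo_rels n"
  by unfold_locales (use q_closed in \<open>auto simp: pseudo_letters_def\<close>)

lemma hecke_eq: "H = C.K" and hecke_proj_eq: "hecke_proj R q n = C.pr"
  by (simp_all add: fun_eq_iff hecke_def hecke_proj_def C.K_def C.pr_def hecke_ideal_def braid_algebra_def
      braid_group_def braid_class_def C.relators_def)

lemma pseudo_hecke_eq: "PH = P.K" and pseudo_hecke_proj_eq: "pseudo_hecke_proj R q n = P.pr"
  by (simp_all add: fun_eq_iff pseudo_hecke_def pseudo_hecke_proj_def P.K_def P.pr_def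
      pseudo_hecke_ideal_def pseudo_algebra_def pseudo_braid_monoid_def pseudo_class_def P.relators_def)

lemma hecke_assoc_algebra: "assoc_algebra R H"
  unfolding hecke_eq by (rule C.K_assoc_algebra)

interpretation H: assoc_algebra R H
  by (rule hecke_assoc_algebra)

definition br :: "letter list \<Rightarrow> (letter list set \<Rightarrow> 'a) set" where
  "br w = hecke_proj R q n (braid_class n w)"

lemma br_closed: "w \<in> lists (braid_letters n) \<Longrightarrow> br w \<in> carrier H"
  using C.pr_word_closed by (simp add: br_def hecke_eq hecke_proj_eq braid_class_def)

lemma br_append:
  "\<lbrakk>u \<in> lists (braid_letters n); v \<in> lists (braid_letters n)\<rbrakk> \<Longrightarrow> br (u @ v) = br u \<otimes>\<^bsub>H\<^esub> br v"
  using C.pr_append by (simp add: br_def hecke_eq hecke_proj_eq braid_class_def)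

lemma br_Nil: "br [] = \<one>\<^bsub>H\<^esub>"
  using C.pr_Nil by (simp add: br_def hecke_eq hecke_proj_eq braid_class_def)

lemma br_rel:
  assumes "(u, v) \<in> braid_rels n" and "u \<in> lists (braid_letters n)" and "v \<in> lists (braid_letters n)"
  shows "word_val H (\<lambda>l. br [l]) u = word_val H (\<lambda>l. br [l]) v"
  using C.pr_rel[OF assms] C.pr_word[OF assms(2)] C.pr_word[OF assms(3)]
  by (simp add: br_def hecke_eq hecke_proj_eq braid_class_def)

lemma letters_closed [simp]:
  assumes "i \<in> {1..<n}"
  shows "br [Sig i] \<in> carrier H" and "br [SigInv i] \<in> carrier H"
  using assms by (auto intro!: br_closed simp: braid_letters_def)

lemma hecke_gen_eq: "hecke_gen R q n i = br [Sig i]"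
  by (simp add: hecke_gen_def br_def)

lemma letters_in_lists:
  assumes "i \<in> {1..<n}"
  shows "Sig i \<in> braid_letters n" "SigInv i \<in> braid_letters n"
    "Sig i \<in> pseudo_letters n" "SigInv i \<in> pseudo_letters n" "Pre i \<in> pseudo_letters n"
  using assms by (auto simp: braid_letters_def pseudo_letters_def)

lemma Sig_SigInv:
  assumes i: "i \<in> {1..<n}"
  shows "br [Sig i] \<otimes>\<^bsub>H\<^esub> br [SigInv i] = \<one>\<^bsub>H\<^esub>" and "br [SigInv i] \<otimes>\<^bsub>H\<^esub> br [Sig i] = \<one>\<^bsub>H\<^esub>"
proof -
  have "([Sig i, SigInv i], []) \<in> braid_rels n" "([SigInv i, Sig i], []) \<in> braid_rels n"
    using i by (auto simp: braid_rels_def)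
  from this[THEN br_rel] show "br [Sig i] \<otimes>\<^bsub>H\<^esub> br [SigInv i] = \<one>\<^bsub>H\<^esub>"
    and "br [SigInv i] \<otimes>\<^bsub>H\<^esub> br [Sig i] = \<one>\<^bsub>H\<^esub>"
    using i by (simp_all add: letters_in_lists)
qed

lemma Sig_comm:
  assumes "i \<in> {1..<n}" and "j \<in> {1..<n}" and "2 \<le> \<bar>int i - int j\<bar>"
  shows "br [Sig i] \<otimes>\<^bsub>H\<^esub> br [Sig j] = br [Sig j] \<otimes>\<^bsub>H\<^esub> br [Sig i]"
proof -
  have "([Sig i, Sig j], [Sig j, Sig i]) \<in> braid_rels n"
    using assms by (auto simp: braid_rels_def)
  from br_rel[OF this] show ?thesis
    using assms(1,2) by (simp add: letters_in_lists)
qed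

lemma Sig_braid:
  assumes "i \<in> {1..<n}" and "i + 1 \<in> {1..<n}"
  shows "br [Sig i] \<otimes>\<^bsub>H\<^esub> (br [Sig (i+1)] \<otimes>\<^bsub>H\<^esub> br [Sig i]) =
    br [Sig (i+1)] \<otimes>\<^bsub>H\<^esub> (br [Sig i] \<otimes>\<^bsub>H\<^esub> br [Sig (i+1)])"
proof -
  have "([Sig i, Sig (i+1), Sig i], [Sig (i+1), Sig i, Sig (i+1)]) \<in> braid_rels n"
    using assms by (auto simp: braid_rels_def)
  from br_rel[OF this] show ?thesis
    using assms letters_in_lists letters_closed by simp
qed

text \<open>Links the inverse in the definition of \<open>rho\<close> to the letter
  \<open>SigInv i\<close>.\<close>

lemma inv_hecke_gen:
  assumes "i \<in> {1..<n}"
  shows "inv\<^bsub>H\<^esub> (hecke_gen R q n i) = br [SigInv i]"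
  unfolding hecke_gen_eq
  using assms H.A.inv_unique'[of "br [Sig i]" "br [SigInv i]"] by (simp add: Sig_SigInv)

fun letter_image :: "letter \<Rightarrow> (letter list set \<Rightarrow> 'a) set" where
  "letter_image (Pre i) = X \<odot>\<^bsub>H\<^esub> br [Sig i] \<oplus>\<^bsub>H\<^esub> Y \<odot>\<^bsub>H\<^esub> br [SigInv i]"
| "letter_image (Sig i) = br [Sig i]"
| "letter_image (SigInv i) = br [SigInv i]"

lemma letter_image_closed: "letter_image \<in> pseudo_letters n \<rightarrow> carrier H"
  using X_closed Y_closed by (auto simp: pseudo_letters_def)

lemma intertwine_SigInv:
  assumes "i \<in> {1..<n}" and "j \<in> {1..<n}" and "z \<in> carrier H"
    and "z \<otimes>\<^bsub>H\<^esub> br [Sig i] = br [Sig j] \<otimes>\<^bsub>H\<^esub> z"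
  shows "z \<otimes>\<^bsub>H\<^esub> br [SigInv i] = br [SigInv j] \<otimes>\<^bsub>H\<^esub> z"
  by (rule H.A.intertwine_inverse[where x = "br [Sig i]" and y = "br [Sig j]"])
    (use assms in \<open>simp_all add: Sig_SigInv\<close>)

text \<open>Reduces a relation that moves a pseudo generator past \<open>z\<close> to the
  corresponding relation for the ordinary generator.\<close>

lemma intertwine_Pre:
  assumes "i \<in> {1..<n}" and "j \<in> {1..<n}" and "z \<in> carrier H"
    and "z \<otimes>\<^bsub>H\<^esub> br [Sig i] = br [Sig j] \<otimes>\<^bsub>H\<^esub> z"
  shows "z \<otimes>\<^bsub>H\<^esub> letter_image (Pre i) = letter_image (Pre j) \<otimes>\<^bsub>H\<^esub> z"
  unfolding letter_image.simps
  by (rule H.intertwine_lincomb) (use assms intertwine_SigInv[OF assms] X_closed Y_closed in simp_all)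

lemma letter_image_rels:
  assumes "(u, v) \<in> braid_rels n \<union> pseudo_rels n" and "u \<in> lists (pseudo_letters n)"
    and "v \<in> lists (pseudo_letters n)"
  shows "word_val H letter_image u = word_val H letter_image v"
proof -
  have closed: "letter_image (Pre i) \<in> carrier H" if "i \<in> {1..<n}" for i
    using that letter_image_closed letters_in_lists by blast
  \<comment> \<open>The case \<open>i = j\<close> is included because the argument uses only that
    the two generators commute; it yields the relations between \<open>\<sigma>\<^sub>i\<close> or
    its inverse and \<open>p\<^sub>i\<close>.\<close>
  have far: "br [Sig j] \<otimes>\<^bsub>H\<^esub> letter_image (Pre i) = letter_image (Pre i) \<otimes>\<^bsub>H\<^esub> br [Sig j]"
    "br [SigInv j] \<otimes>\<^bsub>H\<^esub> letter_image (Pre i) = letter_image (Pre i) \<otimes>\<^bsub>H\<^esub> br [SigInv j]"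
    "letter_image (Pre j) \<otimes>\<^bsub>H\<^esub> letter_image (Pre i) = letter_image (Pre i) \<otimes>\<^bsub>H\<^esub> letter_image (Pre j)"
    if "i \<in> {1..<n}" "j \<in> {1..<n}" "2 \<le> \<bar>int i - int j\<bar> \<or> i = j" for i j
  proof -
    have comm: "br [Sig j] \<otimes>\<^bsub>H\<^esub> br [Sig i] = br [Sig i] \<otimes>\<^bsub>H\<^esub> br [Sig j]"
      using that Sig_comm[of i j] by auto
    show Pre: "br [Sig j] \<otimes>\<^bsub>H\<^esub> letter_image (Pre i) = letter_image (Pre i) \<otimes>\<^bsub>H\<^esub> br [Sig j]"
      by (rule intertwine_Pre) (use that comm in simp_all)
    \<comment> \<open>The roles are exchanged here and in the next claim: the intertwiner is now the
      image of \<open>Pre i\<close>, which commutes with \<open>br [Sig j]\<close> by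
      \<open>Pre\<close>.\<close>
    show "br [SigInv j] \<otimes>\<^bsub>H\<^esub> letter_image (Pre i) = letter_image (Pre i) \<otimes>\<^bsub>H\<^esub> br [SigInv j]"
      by (rule intertwine_SigInv[symmetric])
        (use that Pre[symmetric] closed[OF that(1)] in simp_all)
    show "letter_image (Pre j) \<otimes>\<^bsub>H\<^esub> letter_image (Pre i) = letter_image (Pre i) \<otimes>\<^bsub>H\<^esub> letter_image (Pre j)"
      by (rule intertwine_Pre[symmetric])
        (use that Pre[symmetric] closed[OF that(1)] in simp_all)
  qed
  show ?thesis
  proof (cases "(u, v) \<in> braid_rels n")
    case True
    then have lists: "u \<in> lists (braid_letters n)" "v \<in> lists (braid_letters n)"
      by (auto simp: braid_rels_def letters_in_lists)
    have "word_val H letter_image w = word_val H (\<lambda>l. br [l]) w" if "w \<in> lists (braid_letters n)" for w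
      using that by induction (auto simp: braid_letters_def)
    then show ?thesis
      using br_rel[OF True lists] lists by simp
  next
    case False
    have far': "word_val H letter_image [Pre i, Sig j] = word_val H letter_image [Sig j, Pre i]"
        "word_val H letter_image [Pre i, SigInv j] = word_val H letter_image [SigInv j, Pre i]"
        "word_val H letter_image [Pre i, Pre j] = word_val H letter_image [Pre j, Pre i]"
      if "i \<in> {1..<n}" "j \<in> {1..<n}" "2 \<le> \<bar>int i - int j\<bar> \<or> i = j" for i j
      using far[OF that] closed[OF that(1)] closed[OF that(2)] letters_closed[OF that(2)]
      by (simp_all del: letter_image.simps(1))
    \<comment> \<open>By the braid relation the product of the images of
      \<open>\<sigma>\<^sub>i\<close> and \<open>\<sigma>\<^sub>i\<^sub>+\<^sub>1\<close>, in this
      order, carries the first generator to the second; the opposite order carries the second to the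
      first.\<close>
    have slide: "word_val H letter_image [Sig i, Sig (i+1), Pre i] =
          word_val H letter_image [Pre (i+1), Sig i, Sig (i+1)]"
        "word_val H letter_image [Sig (i+1), Sig i, Pre (i+1)] =
          word_val H letter_image [Pre i, Sig (i+1), Sig i]"
      if i: "i \<in> {1..<n}" "i + 1 \<in> {1..<n}" for i
      using intertwine_Pre[OF i(1) i(2), of "br [Sig i] \<otimes>\<^bsub>H\<^esub> br [Sig (i+1)]"]
        intertwine_Pre[OF i(2) i(1), of "br [Sig (i+1)] \<otimes>\<^bsub>H\<^esub> br [Sig i]"]
        letters_closed[OF i(1)] letters_closed[OF i(2)] closed[OF i(1)] closed[OF i(2)] Sig_braid[OF i]
      by (simp_all add: H.A.m_assoc del: letter_image.simps(1))
    have "(u, v) \<in> pseudo_rels n"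
      using assms(1) False by simp
    then show ?thesis
      unfolding pseudo_rels_def
    proof (elim UnE)
    qed ((clarify, rule far' slide; simp)+)
  qed
qed

text \<open>The defining properties of \<^const>\<open>rho\<close> determine it on the inverses of the generators, since
  algebra homomorphisms preserve inverses.\<close>

lemma rho_word:
  assumes w: "w \<in> lists (pseudo_letters n)"
  shows "rho R q X Y n (pseudo_hecke_proj R q n (pseudo_class n w)) = word_val H letter_image w"
proof -
  let ?p = "\<lambda>w. pseudo_hecke_proj R q n (pseudo_class n w)"
  have pr: "?p w = P.pr (word_class (pseudo_letters n) (braid_rels n \<union> pseudo_rels n) w)" for w
    by (simp add: pseudo_hecke_proj_eq pseudo_class_def)
  have p_closed: "?p w \<in> carrier PH" if "w \<in> lists (pseudo_letters n)" for w
    unfolding pr pseudo_hecke_eq using that by (rule P.pr_word_closed)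
  interpret PH: assoc_algebra R PH
    unfolding pseudo_hecke_eq by (rule P.K_assoc_algebra)
  \<comment> \<open>The image of \<open>Sig i\<close> is the generator of \<open>H\<close>, which
    satisfies the quadratic relation by construction.\<close>
  have quad: "P.quadratic H (letter_image (Sig i))" if "i \<in> {1..<n}" for i
    using C.quadratic_pr[OF that]
    by (simp add: br_def hecke_eq hecke_proj_eq braid_class_def)
  obtain f where f: "f \<in> alg_hom R PH H"
    and f_word: "\<And>w. w \<in> lists (pseudo_letters n) \<Longrightarrow> f (?p w) = word_val H letter_image w"
  proof (rule P.alg_hom_exists[OF hecke_assoc_algebra letter_image_closed, folded pr pseudo_hecke_eq])
    show "word_val H letter_image u = word_val H letter_image v"
      if "(u, v) \<in> braid_rels n \<union> pseudo_rels n" "u \<in> lists (pseudo_letters n)"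
        "v \<in> lists (pseudo_letters n)" for u v
      by (rule letter_image_rels[OF that])
    show "P.quadratic H (letter_image (Sig i))" if "i \<in> {1..<n}" for i
      by (rule quad[OF that])
  qed (rule that)
  \<comment> \<open>\<open>rho\<close> is described among extensional functions, so \<open>f\<close>
    is made \<open>undefined\<close> outside the carrier.\<close>
  define F where "F = restrict f (carrier PH)"
  have F_word: "F (?p w) = word_val H letter_image w" if "w \<in> lists (pseudo_letters n)" for w
    using f_word[OF that] p_closed[OF that] by (simp add: F_def)
  have F_hom: "F \<in> alg_hom R PH H"
    unfolding alg_hom_def F_def using alg_hom_props[OF f]
    by (auto intro!: ring_hom_memI)
  have F_letter: "F (?p [l]) = letter_image l" if "l \<in> pseudo_letters n" for l
    using F_word[of "[l]"] that funcset_mem[OF letter_image_closed that] by simp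
  have "rho R q X Y n = F"
    unfolding rho_def
  proof (rule the_equality, intro conjI ballI)
    show "F \<in> alg_hom R PH H" by (rule F_hom)
    show "F \<in> extensional (carrier PH)" by (simp add: F_def)
    fix i assume i: "i \<in> {1..<n}"
    show "F (?p [Sig i]) = hecke_gen R q n i"
      using F_letter i by (simp add: letters_in_lists hecke_gen_eq)
    show "F (?p [Pre i]) = X \<odot>\<^bsub>H\<^esub> hecke_gen R q n i \<oplus>\<^bsub>H\<^esub> Y \<odot>\<^bsub>H\<^esub> inv\<^bsub>H\<^esub> (hecke_gen R q n i)"
      using F_letter i by (simp add: letters_in_lists inv_hecke_gen) (simp add: hecke_gen_eq)
  next
    fix g assume g: "g \<in> alg_hom R PH H \<and> g \<in> extensional (carrier PH) \<and>
      (\<forall>i\<in>{1..<n}. g (?p [Sig i]) = hecke_gen R q n i \<and>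
        g (?p [Pre i]) = X \<odot>\<^bsub>H\<^esub> hecke_gen R q n i \<oplus>\<^bsub>H\<^esub> Y \<odot>\<^bsub>H\<^esub> inv\<^bsub>H\<^esub> (hecke_gen R q n i))"
    then have g_hom: "g \<in> alg_hom R PH H" and g_ext: "g \<in> extensional (carrier PH)" by auto
    have g_letter: "g (?p [l]) = letter_image l" if "l \<in> pseudo_letters n" for l
    proof (cases l)
      case (Sig i)
      then show ?thesis
        using that g by (auto simp: pseudo_letters_def hecke_gen_eq)
    next
      case (Pre i)
      then have "i \<in> {1..<n}"
        using that by (auto simp: pseudo_letters_def)
      then show ?thesis
        using g Pre inv_hecke_gen[of i] by (simp add: hecke_gen_eq)
    next
      case (SigInv i)
      then have i: "i \<in> {1..<n}"
        using that by (auto simp: pseudo_letters_def)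
      have rels: "([Sig i, SigInv i], []) \<in> braid_rels n \<union> pseudo_rels n"
        "([SigInv i, Sig i], []) \<in> braid_rels n \<union> pseudo_rels n"
        using i by (auto simp: braid_rels_def)
      have lists: "[Sig i] \<in> lists (pseudo_letters n)" "[SigInv i] \<in> lists (pseudo_letters n)"
        using i by (auto simp: letters_in_lists)
      have "?p [Sig i] \<otimes>\<^bsub>PH\<^esub> ?p [SigInv i] = \<one>\<^bsub>PH\<^esub>" "?p [SigInv i] \<otimes>\<^bsub>PH\<^esub> ?p [Sig i] = \<one>\<^bsub>PH\<^esub>"
        using rels[THEN P.pr_rel] lists P.pr_append[OF lists] P.pr_append[OF lists(2) lists(1)] P.pr_Nil
        by (simp_all add: pseudo_hecke_eq pr)
      then have "g (?p [Sig i]) \<otimes>\<^bsub>H\<^esub> g (?p [SigInv i]) = \<one>\<^bsub>H\<^esub>"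
        "g (?p [SigInv i]) \<otimes>\<^bsub>H\<^esub> g (?p [Sig i]) = \<one>\<^bsub>H\<^esub>"
        using alg_hom_props[OF g_hom] p_closed[OF lists(1)] p_closed[OF lists(2)] by metis+
      then have "g (?p [SigInv i]) = inv\<^bsub>H\<^esub> (hecke_gen R q n i)"
        using g i alg_hom_props(1)[OF g_hom p_closed[OF lists(2)]]
        by (intro H.A.inv_unique') (auto simp: hecke_gen_eq)
      then show ?thesis
        using SigInv i by (simp add: inv_hecke_gen)
    qed
    \<comment> \<open>On the carrier, agreement on letters is enough; outside it both functions are
      \<open>undefined\<close>.\<close>
    show "g = F"
    proof (rule extensionalityI[OF g_ext])
      show "F \<in> extensional (carrier PH)" by (simp add: F_def)
      show "g U = F U" if "U \<in> carrier PH" for U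
        by (rule P.alg_hom_eqI[OF hecke_assoc_algebra, folded pr pseudo_hecke_eq, OF g_hom F_hom _ that])
          (simp add: g_letter F_letter)
    qed
  qed
  then show ?thesis
    using F_word[OF w] by simp
qed

end


subsection \<open>States\<close>

text \<open>Words grow at the right end, so earlier pseudo generators keep their positions and
  states need no reindexing.\<close>

lemma pre_positions_snoc:
  "pre_positions (w @ [l]) = (if is_pre l then insert (length w) (pre_positions w) else pre_positions w)"
  by (auto simp: pre_positions_def nth_append less_Suc_eq)

lemma finite_pre_positions: "finite (pre_positions w)"
  by (simp add: pre_positions_def)

lemma length_notin_pre_positions: "length w \<notin> pre_positions w"
  by (simp add: pre_positions_def)

lemma finite_states: "finite (states w)"
  by (auto simp: states_def finite_pre_positions intro!: finite_PiE)

definition resolve_letter :: "letter \<Rightarrow> bool \<Rightarrow> letter" where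
  "resolve_letter l b = (case l of Pre i \<Rightarrow> (if b then Sig i else SigInv i) | l \<Rightarrow> l)"

lemma resolve_snoc: "resolve (w @ [l]) s = resolve w s @ [resolve_letter l (s (length w))]"
  by (simp add: resolve_def resolve_letter_def nth_append)

text \<open>The position \<open>length w\<close> lies just beyond \<open>w\<close>, so a choice made
  there is invisible to \<open>w\<close>.\<close>

lemma resolve_upd: "resolve w (s(length w := b)) = resolve w s"
  by (auto simp: resolve_def split: letter.split)

lemma resolve_in_lists: "w \<in> lists (pseudo_letters n) \<Longrightarrow> resolve w s \<in> lists (braid_letters n)"
proof (induction w rule: rev_induct)
  case Nil
  then show ?case by (simp add: resolve_def)
next
  case (snoc l w)
  have "resolve_letter l b \<in> braid_letters n" if "l \<in> pseudo_letters n" for b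
    using that by (auto simp: pseudo_letters_def braid_letters_def resolve_letter_def)
  then show ?case
    using snoc by (simp add: resolve_snoc)
qed

lemma r_plus_snoc: "r_plus (w @ [l]) s = r_plus w s + (if is_pre l \<and> s (length w) then 1 else 0)"
proof -
  have "{k \<in> pre_positions (w @ [l]). s k} =
      (if is_pre l \<and> s (length w) then insert (length w) {k \<in> pre_positions w. s k}
       else {k \<in> pre_positions w. s k})"
    by (auto simp: pre_positions_snoc)
  then show ?thesis
    by (simp add: r_plus_def finite_pre_positions length_notin_pre_positions)
qed

lemma r_minus_snoc:
  "r_minus (w @ [l]) s = r_minus w s + (if is_pre l \<and> \<not> s (length w) then 1 else 0)"
proof -
  have "{k \<in> pre_positions (w @ [l]). \<not> s k} =
      (if is_pre l \<and> \<not> s (length w) then insert (length w) {k \<in> pre_positions w. \<not> s k}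
       else {k \<in> pre_positions w. \<not> s k})"
    by (auto simp: pre_positions_snoc)
  then show ?thesis
    by (simp add: r_minus_def finite_pre_positions length_notin_pre_positions)
qed

lemma r_upd:
  "r_plus w (s(length w := b)) = r_plus w s" "r_minus w (s(length w := b)) = r_minus w s"
proof -
  have "{k \<in> pre_positions w. (s(length w := b)) k} = {k \<in> pre_positions w. s k}"
    "{k \<in> pre_positions w. \<not> (s(length w := b)) k} = {k \<in> pre_positions w. \<not> s k}"
    by (auto simp: pre_positions_def)
  then show "r_plus w (s(length w := b)) = r_plus w s" "r_minus w (s(length w := b)) = r_minus w s"
    by (simp_all only: r_plus_def r_minus_def)
qed

lemma word_exp_resolve: "word_exp (resolve w s) = word_exp w + int (r_plus w s) - int (r_minus w s)"
proof (induction w rule: rev_induct)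
  case Nil
  then show ?case
    by (simp add: resolve_def r_plus_def r_minus_def pre_positions_def)
next
  case (snoc l w)
  then show ?case
    by (cases l) (auto simp: resolve_snoc r_plus_snoc r_minus_snoc word_exp_def resolve_letter_def)
qed

lemma states_snoc_not_pre: "\<not> is_pre l \<Longrightarrow> states (w @ [l]) = states w"
  by (simp add: states_def pre_positions_snoc)

text \<open>Every state of the longer word arises from a state of \<open>w\<close> by overwriting
  its value at the new position with one of the two signs.\<close>

lemma states_snoc_pre:
  assumes "is_pre l"
  shows "states (w @ [l]) = (\<lambda>s. s(length w := True)) ` states w \<union> (\<lambda>s. s(length w := False)) ` states w"
proof -
  have "states (w @ [l]) = (\<lambda>(b, s). s(length w := b)) ` (UNIV \<times> states w)"
    using assms by (simp add: states_def pre_positions_snoc PiE_insert_eq)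
  also have "\<dots> = (\<lambda>s. s(length w := True)) ` states w \<union> (\<lambda>s. s(length w := False)) ` states w"
    by (auto simp: UNIV_bool image_iff)
  finally show ?thesis .
qed

text \<open>All states of \<open>w\<close> take the default value \<open>undefined\<close> at
  \<open>length w\<close>, so overwriting it loses no information.\<close>

lemma inj_on_states_upd: "inj_on (\<lambda>s. s(length w := b)) (states w)"
proof (rule inj_onI)
  fix s s' assume s: "s \<in> states w" "s' \<in> states w" and eq: "s(length w := b) = s'(length w := b)"
  have "s (length w) = s' (length w)"
    using s length_notin_pre_positions by (metis PiE_arb states_def)
  then show "s = s'"
    using fun_cong[OF eq] by (intro ext) (metis fun_upd_other)
qed

lemma (in abelian_monoid) finsum_states_snoc:
  assumes l: "is_pre l" and f: "f \<in> states (w @ [l]) \<rightarrow> carrier G"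
  shows "finsum G f (states (w @ [l])) =
    (\<Oplus>s\<in>states w. f (s(length w := True)) \<oplus> f (s(length w := False)))"
proof -
  let ?u = "\<lambda>b s. s(length w := b)"
  have disjoint: "?u True ` states w \<inter> ?u False ` states w = {}"
    by (auto dest!: fun_cong[of _ _ "length w"])
  have f': "f \<in> ?u b ` states w \<rightarrow> carrier G" for b
    using f unfolding states_snoc_pre[OF l] by (cases b) auto
  have "finsum G f (states (w @ [l])) = finsum G f (?u True ` states w) \<oplus> finsum G f (?u False ` states w)"
    unfolding states_snoc_pre[OF l]
    by (rule finsum_Un_disjoint[OF _ _ disjoint f' f']) (simp_all add: finite_states)
  also have "\<dots> = (\<Oplus>s\<in>states w. f (?u True s)) \<oplus> (\<Oplus>s\<in>states w. f (?u False s))"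
    using f' by (simp add: finsum_reindex inj_on_states_upd)
  also have "\<dots> = (\<Oplus>s\<in>states w. f (?u True s) \<oplus> f (?u False s))"
    using f'[of True] f'[of False] by (intro finsum_addf[symmetric]) auto
  finally show ?thesis .
qed

context rho_setup
begin

text \<open>Appending a letter multiplies the sum by the image of that letter on the right. For a
  pseudo generator this splits each term in two, matching the two extensions of each state.\<close>

lemma state_sum:
  assumes "w \<in> lists (pseudo_letters n)"
  shows "word_val H letter_image w =
    (\<Oplus>\<^bsub>H\<^esub>s\<in>states w. (X [^] r_plus w s \<otimes> Y [^] r_minus w s) \<odot>\<^bsub>H\<^esub> br (resolve w s))"
  using assms
proof (induction w rule: rev_induct)
  interpret H: assoc_algebra R H by (rule hecke_assoc_algebra)
  case Nil
  \<comment> \<open>The empty word has exactly one state, the everywhere \<open>undefined\<close>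
    function, which contributes the unit.\<close>
  have "states [] = {\<lambda>_. undefined}" "\<And>s. resolve [] s = []" "\<And>s. r_plus [] s = 0" "\<And>s. r_minus [] s = 0"
    by (simp_all add: states_def pre_positions_def resolve_def r_plus_def r_minus_def)
  then show ?case
    by (simp add: br_Nil)
next
  interpret H: assoc_algebra R H by (rule hecke_assoc_algebra)
  case (snoc l w)
  then have w: "w \<in> lists (pseudo_letters n)" and l: "l \<in> pseudo_letters n"
    by auto
  define c where "c s = X [^] r_plus w s \<otimes> Y [^] r_minus w s" for s
  define h where "h s = br (resolve w s)" for s
  have c: "c s \<in> carrier R" and h: "h s \<in> carrier H" for s
    using br_closed[OF resolve_in_lists[OF w]] X_closed Y_closed by (simp_all add: c_def h_def)
  have img: "letter_image l \<in> carrier H"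
    by (rule funcset_mem[OF letter_image_closed l])
  have "word_val H letter_image (w @ [l]) = word_val H letter_image w \<otimes>\<^bsub>H\<^esub> letter_image l"
    using word_val_append[OF H.A.monoid_axioms letter_image_closed w, of "[l]"] l img by simp
  also have "\<dots> = (\<Oplus>\<^bsub>H\<^esub>s\<in>states w. c s \<odot>\<^bsub>H\<^esub> h s) \<otimes>\<^bsub>H\<^esub> letter_image l"
    using snoc.IH[OF w] by (simp add: c_def h_def)
  also have "\<dots> = (\<Oplus>\<^bsub>H\<^esub>s\<in>states w. (c s \<odot>\<^bsub>H\<^esub> h s) \<otimes>\<^bsub>H\<^esub> letter_image l)"
    using finite_states img c h by (intro H.A.finsum_ldistr) auto
  also have "\<dots> = (\<Oplus>\<^bsub>H\<^esub>s\<in>states (w @ [l]).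
      (X [^] r_plus (w @ [l]) s \<otimes> Y [^] r_minus (w @ [l]) s) \<odot>\<^bsub>H\<^esub> br (resolve (w @ [l]) s))"
    (is "_ = finsum H ?f _")
  proof (cases "is_pre l")
    case False
    then have b: "resolve_letter l b = l" "letter_image l = br [l]" "l \<in> braid_letters n" for b
      using l by (cases l; auto simp: resolve_letter_def pseudo_letters_def braid_letters_def)+
    have "(c s \<odot>\<^bsub>H\<^esub> h s) \<otimes>\<^bsub>H\<^esub> letter_image l = ?f s" for s
      using c h False b img br_append[OF resolve_in_lists[OF w], of "[l]"]
      by (simp add: c_def h_def r_plus_snoc r_minus_snoc resolve_snoc H.smult_mult_l)
    then show ?thesis
      using False by (simp add: states_snoc_not_pre)
  next
    case True
    then obtain i where l_eq: "l = Pre i"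
      by (cases l) auto
    have i: "i \<in> {1..<n}"
      using l by (auto simp: l_eq pseudo_letters_def)
    have f: "?f s \<in> carrier H" for s
      using br_closed[OF resolve_in_lists[OF snoc.prems]] X_closed Y_closed by simp
    have "(c s \<odot>\<^bsub>H\<^esub> h s) \<otimes>\<^bsub>H\<^esub> letter_image l = ?f (s(length w := True)) \<oplus>\<^bsub>H\<^esub> ?f (s(length w := False))"
      for s
    proof -
      have br: "br (resolve w s @ [Sig i]) = h s \<otimes>\<^bsub>H\<^esub> br [Sig i]"
        "br (resolve w s @ [SigInv i]) = h s \<otimes>\<^bsub>H\<^esub> br [SigInv i]"
        using br_append[OF resolve_in_lists[OF w]] i by (simp_all add: h_def letters_in_lists)
      have "(c s \<odot>\<^bsub>H\<^esub> h s) \<otimes>\<^bsub>H\<^esub> letter_image l =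
          (X \<otimes> c s) \<odot>\<^bsub>H\<^esub> (h s \<otimes>\<^bsub>H\<^esub> br [Sig i]) \<oplus>\<^bsub>H\<^esub> (Y \<otimes> c s) \<odot>\<^bsub>H\<^esub> (h s \<otimes>\<^bsub>H\<^esub> br [SigInv i])"
        using c h X_closed Y_closed letters_closed[OF i]
        by (simp add: l_eq H.A.r_distr H.smult_mult_l H.smult_mult_r H.smult_r_distr H.smult_assoc1)
      \<comment> \<open>The new scalar factor raises the exponent that counts the chosen sign and
        leaves the other alone.\<close>
      moreover have "X \<otimes> c s = X [^] (r_plus w s + 1) \<otimes> Y [^] r_minus w s"
        "Y \<otimes> c s = X [^] r_plus w s \<otimes> Y [^] (r_minus w s + 1)"
        using X_closed Y_closed by (simp_all add: c_def m_ac)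
      ultimately show ?thesis
        by (simp add: l_eq resolve_letter_def resolve_snoc r_plus_snoc r_minus_snoc resolve_upd r_upd br)
    qed
    then show ?thesis
      using f H.finsum_states_snoc[OF True, of ?f w] by simp
  qed
  finally show ?case .
qed

end


subsection \<open>Normalization\<close>

text \<open>Transfers integer powers of a unit to the group of units, where the exponent laws hold
  for negative exponents as well.\<close>

lemma (in Group.monoid) units_of_int_pow:
  assumes "x \<in> Units G"
  shows "x [^]\<^bsub>units_of G\<^esub> (k::int) = x [^] k"
proof -
  have "x [^]\<^bsub>units_of G\<^esub> m = x [^] m" and "x [^] m \<in> Units G" for m :: nat
    by (induction m) (simp_all add: assms units_of_mult units_of_one)
  then show ?thesis
    by (simp add: int_pow_def2 units_of_inv del: pow_nat)
qed

lemma (in Group.monoid) Units_int_pow_add: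
  assumes "x \<in> Units G"
  shows "x [^] (j + k :: int) = x [^] j \<otimes> x [^] k" and "x [^] k \<in> carrier G"
proof -
  interpret U: group "units_of G" by (rule units_group)
  have x: "x \<in> carrier (units_of G)"
    using assms by (simp add: units_of_carrier)
  show "x [^] (j + k) = x [^] j \<otimes> x [^] k"
    using U.int_pow_mult[OF x, of j k] by (simp add: units_of_int_pow[OF assms] units_of_mult)
  have "x [^] k \<in> Units G"
    using U.int_pow_closed[OF x, of k] by (simp add: units_of_int_pow[OF assms] units_of_carrier)
  then show "x [^] k \<in> carrier G" ..
qed

lemma (in comm_monoid) state_coeff:
  assumes B: "B \<in> Units G" and X: "X \<in> carrier G" and Y: "Y \<in> carrier G"
  shows "(X \<otimes> inv B) [^] (p::nat) \<otimes> (Y \<otimes> B) [^] (m::nat) \<otimes> B [^] (e + int p - int m) =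
    X [^] p \<otimes> Y [^] m \<otimes> B [^] (e::int)"
proof -
  have Bc: "B \<in> carrier G" "inv B \<in> carrier G"
    using B by auto
  \<comment> \<open>Factoring out \<open>D\<close> leaves only the natural powers
    \<open>B [^] m\<close> and \<open>B [^] p\<close> in the two integer powers of \<open>B\<close>
    to be compared.\<close>
  define D where "D = B [^] (e - int m)"
  have D: "D \<in> carrier G"
    unfolding D_def by (rule Units_int_pow_add(2)[OF B])
  have e: "B [^] e = B [^] m \<otimes> D"
    using Units_int_pow_add(1)[OF B, of "int m" "e - int m"] by (simp add: D_def int_pow_int)
  have pm: "B [^] (e + int p - int m) = B [^] p \<otimes> D"
    using Units_int_pow_add(1)[OF B, of "int p" "e - int m"] by (simp add: D_def int_pow_int algebra_simps)
  have cancel: "inv B [^] p \<otimes> B [^] p = \<one>"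
    using B Bc by (simp flip: nat_pow_distrib)
  have "(X \<otimes> inv B) [^] p \<otimes> (Y \<otimes> B) [^] m \<otimes> B [^] (e + int p - int m) =
      (inv B [^] p \<otimes> B [^] p) \<otimes> (X [^] p \<otimes> Y [^] m \<otimes> (B [^] m \<otimes> D))"
    using X Y Bc D by (simp add: nat_pow_distrib pm m_ac)
  then show ?thesis
    using X Y Bc D by (simp add: cancel e)
qed

text \<open>The inverse of \<open>B\<close> is
  \<open>B \<otimes> inv (B \<otimes> B)\<close>.\<close>

lemma (in comm_monoid) Units_of_square:
  assumes B: "B \<in> carrier G" and "B [^] (2::nat) \<in> Units G"
  shows "B \<in> Units G"
proof -
  have sq: "B \<otimes> B \<in> Units G"
    using assms by (simp add: numeral_2_eq_2)
  then have "B \<otimes> (B \<otimes> inv (B \<otimes> B)) = \<one>"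
    using B by (simp flip: m_assoc)
  moreover have "B \<otimes> inv (B \<otimes> B) \<in> carrier G"
    using B sq by simp
  ultimately show ?thesis
    using B m_comm unfolding Units_def by fastforce
qed

section \<open>The normalized state sum\<close>

theorem theorem6p4:
  fixes R :: "('r, 'x) ring_scheme" (structure)
    and q z z_minus X Y A B C :: 'r
    and tr :: "nat \<Rightarrow> (letter list set \<Rightarrow> 'r) set \<Rightarrow> 'r"
    and n d :: nat
    and w :: "letter list"
    and \<alpha> :: "letter list set"
  assumes "cring R"
    and "q \<in> Units R" and "z \<in> Units R" and "X \<in> carrier R" and "Y \<in> carrier R"
    and "z_minus = inv q \<otimes> z \<oplus> inv q \<ominus> \<one>" and "z_minus \<in> Units R"
    and "X \<otimes> z \<oplus> Y \<otimes> z_minus \<in> Units R"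
    and "B \<in> carrier R" and "B [^] (2::nat) = z_minus \<otimes> inv z"
    and "A = inv (B \<otimes> z)"
    and "C = inv (A \<otimes> (X \<otimes> z \<oplus> Y \<otimes> z_minus))"
    and "ocneanu_trace R q z tr"
    and "n \<ge> 1"
    and "w \<in> lists (pseudo_letters n)"
    and "\<alpha> = pseudo_class n w"
    and "pre_count \<alpha> = d"
  shows "pseudo_P R q X Y A B C tr n \<alpha> =
    C [^] d \<otimes>
      (\<Oplus>s\<in>states w. (X \<otimes> inv B) [^] r_plus w s \<otimes> (Y \<otimes> B) [^] r_minus w s \<otimes>
                     classical_H R q A B tr n (braid_class n (resolve w s)))"
proof -
  interpret R: cring R by fact
  note w = \<open>w \<in> lists (pseudo_letters n)\<close>
  have q: "q \<in> carrier R" using \<open>q \<in> Units R\<close> by blast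
  interpret rho_setup R q X Y n
    using q assms(4,5) by unfold_locales
  \<comment> \<open>\<open>B\<close> is given only as an element of the carrier; its square
    \<open>z_minus \<otimes> inv z\<close> is a product of units, so \<open>B\<close> is a unit and
    \<open>inv B\<close> is a true inverse.\<close>
  have B: "B \<in> Units R"
    by (rule R.Units_of_square) (use assms(3,7,9,10) in simp_all)
  have A: "A \<in> Units R"
    using B assms(3,11) by simp
  have C: "C \<in> carrier R"
    using A assms(8,12) by simp
  have carr: "A \<in> carrier R" "B \<in> carrier R" "inv B \<in> carrier R"
    using A B by auto
  define c where "c s = X [^] r_plus w s \<otimes> Y [^] r_minus w s" for s
  define t where "t s = tr n (br (resolve w s))" for s
  define a where "a = A [^] (n - 1)"
  \<comment> \<open>Viewed as a linear map into \<open>regular_module R\<close>, the trace can be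
    taken inside the state sum.\<close>
  have lin: "tr n \<in> linear_maps R H (regular_module R)"
    using \<open>ocneanu_trace R q z tr\<close> \<open>n \<ge> 1\<close>
    by (auto simp: ocneanu_trace_def linear_form_def linear_maps_def)
  have br: "br (resolve w s) \<in> carrier H" for s
    by (rule br_closed[OF resolve_in_lists[OF w]])
  have Hmod: "module R H"
    using hecke_assoc_algebra by (simp add: assoc_algebra_def)
  have c: "c s \<in> carrier R" for s
    using assms(4,5) by (simp add: c_def)
  have t: "t s \<in> carrier R" for s
    using lin br by (auto simp: t_def linear_maps_def)
  have a: "a \<in> carrier R"
    using carr by (simp add: a_def)
  have Be: "B [^] k \<in> carrier R" for k :: int
    by (rule R.Units_int_pow_add(2)[OF B])
  have T: "T_pseudo R q X Y tr n \<alpha> = (\<Oplus>s\<in>states w. c s \<otimes> t s)"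
  proof -
    have "T_pseudo R q X Y tr n \<alpha> = tr n (\<Oplus>\<^bsub>H\<^esub>s\<in>states w. c s \<odot>\<^bsub>H\<^esub> br (resolve w s))"
      by (simp add: T_pseudo_def \<open>\<alpha> = pseudo_class n w\<close> rho_word[OF w] state_sum[OF w] c_def)
    also have "\<dots> = (\<Oplus>s\<in>states w. tr n (c s \<odot>\<^bsub>H\<^esub> br (resolve w s)))"
      using linear_map_finsum[OF Hmod R.module_regular_module lin,
          of "\<lambda>s. c s \<odot>\<^bsub>H\<^esub> br (resolve w s)" "states w"]
        module.smult_closed[OF Hmod c br] by simp
    also have "\<dots> = (\<Oplus>s\<in>states w. c s \<otimes> t s)"
      using lin c br t by (intro R.finsum_cong') (auto simp: linear_maps_def t_def)
    finally show ?thesis .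
  qed
  have H_state: "classical_H R q A B tr n (braid_class n (resolve w s)) =
      a \<otimes> B [^] (word_exp w + int (r_plus w s) - int (r_minus w s)) \<otimes> t s" for s
    using exp_sum_braid_class[OF resolve_in_lists[OF w]]
    by (simp add: classical_H_def word_exp_resolve t_def br_def a_def)
  \<comment> \<open>The powers of \<open>B\<close> that depend on the state cancel by
    \<open>state_coeff\<close>, leaving the factor \<open>a \<otimes> B [^] word_exp w\<close>
    common to all states.\<close>
  have summand: "(X \<otimes> inv B) [^] r_plus w s \<otimes> (Y \<otimes> B) [^] r_minus w s \<otimes>
      classical_H R q A B tr n (braid_class n (resolve w s)) = a \<otimes> B [^] word_exp w \<otimes> (c s \<otimes> t s)" for s
  proof -
    let ?XY = "(X \<otimes> inv B) [^] r_plus w s \<otimes> (Y \<otimes> B) [^] r_minus w s"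
    let ?B = "B [^] (word_exp w + int (r_plus w s) - int (r_minus w s))"
    have XY: "?XY \<in> carrier R"
      using carr assms(4,5) by simp
    have "?XY \<otimes> (a \<otimes> ?B \<otimes> t s) = a \<otimes> (?XY \<otimes> ?B) \<otimes> t s"
      using XY a Be t by (simp add: R.m_ac)
    also have "?XY \<otimes> ?B = c s \<otimes> B [^] word_exp w"
      unfolding c_def by (rule R.state_coeff[OF B assms(4,5)])
    also have "a \<otimes> (c s \<otimes> B [^] word_exp w) \<otimes> t s = a \<otimes> B [^] word_exp w \<otimes> (c s \<otimes> t s)"
      using a Be c t by (simp add: R.m_ac)
    finally show ?thesis
      by (simp add: H_state)
  qed
  have "pseudo_P R q X Y A B C tr n \<alpha> =
      a \<otimes> B [^] word_exp w \<otimes> C [^] d \<otimes> (\<Oplus>s\<in>states w. c s \<otimes> t s)"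
    unfolding pseudo_P_def T a_def
    using assms(16,17) exp_sum_pseudo_class(1)[OF w] by simp
  also have "\<dots> = C [^] d \<otimes> (a \<otimes> B [^] word_exp w \<otimes> (\<Oplus>s\<in>states w. c s \<otimes> t s))"
    using a Be C c t by (simp add: R.m_ac R.finsum_closed Pi_def)
  also have "a \<otimes> B [^] word_exp w \<otimes> (\<Oplus>s\<in>states w. c s \<otimes> t s) =
      (\<Oplus>s\<in>states w. a \<otimes> B [^] word_exp w \<otimes> (c s \<otimes> t s))"
    using a Be c t by (intro R.finsum_rdistr finite_states) auto
  finally show ?thesis
    by (simp add: summand)
qed

end
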